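(* Let $d\geq2$ be an integer and $w\geq\bigl(3d+2+\sqrt{9d^2+4d+4}\bigr)/2$ a real number. Let $a,b$ be distinct positive integers. Define $(a_{n,w})_{n\geq1}$ by $a_{n,w}=b$ if $n=\lfloor w^i\rfloor$ for some integer $i\geq0$, and $a_{n,w}=a$ otherwise. Let $\xi_w:=[0,a_{1,w},a_{2,w},\ldots]\in\mathbb{R}$ (regular continued fraction). Then \[ w_n^{*}(\xi_w)=w-1,\qquad w_n(\xi_w)=w \] for all $2\leq n\leq d$.
   Context: For a real number $\xi$ and an integer $n\geq1$: $w_n(\xi)$ is the supremum of real $w$ such that $0<|P(\xi)|\leq H(P)^{-w}$ for infinitely many $P\in\mathbb{Z}[X]$ of degree at most $n$, where $H(P)$ is the maximum of the absolute values of the coefficients of $P$; $w_n^{*}(\xi)$ is the supremum of real $w^*$ such that $0<|\xi-\alpha|\leq H(\alpha)^{-w^*-1}$ for infinitely many real algebraic numbers $\alpha$ of degree at most $n$, where $H(\alpha)$ is the height of the minimal polynomial of $\alpha$ over $\mathbb{Z}$. *)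

theory Defs
  imports "HOL-Analysis.Analysis" "HOL-Computational_Algebra.Computational_Algebra"
begin

definition poly_height :: "int poly \<Rightarrow> int" where
  "poly_height P = Max ((\<lambda>i. \<bar>coeff P i\<bar>) ` {..degree P})"

text \<open>
  The minimal polynomial over the integers is normalised to be primitive with positive
  leading coefficient, which makes it unique (see the lemmas below).
\<close>

definition is_int_min_poly :: "real \<Rightarrow> int poly \<Rightarrow> bool" where
  "is_int_min_poly \<alpha> P \<longleftrightarrow>
     poly (map_poly of_int P) \<alpha> = 0 \<and> content P = 1 \<and> lead_coeff P > 0 \<and>
     (\<forall>Q :: int poly. Q \<noteq> 0 \<longrightarrow> poly (map_poly of_int Q) \<alpha> = 0 \<longrightarrow> degree P \<le> degree Q)"

definition int_min_poly :: "real \<Rightarrow> int poly" where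
  "int_min_poly \<alpha> = (THE P. is_int_min_poly \<alpha> P)"

definition alg_degree :: "real \<Rightarrow> nat" where
  "alg_degree \<alpha> = degree (int_min_poly \<alpha>)"

definition alg_height :: "real \<Rightarrow> int" where
  "alg_height \<alpha> = poly_height (int_min_poly \<alpha>)"

text \<open>
  The suprema are taken in the extended reals, so that the value \<open>\<infinity>\<close> is possible.
  In both definitions the base of \<open>powr\<close> is at least 1: a polynomial \<open>P\<close>
  with \<open>P(\<xi>) \<noteq> 0\<close> and a minimal polynomial are nonzero.
\<close>

definition w_exp :: "nat \<Rightarrow> real \<Rightarrow> ereal" where
  "w_exp n \<xi> = Sup {ereal w | w :: real.
     infinite {P :: int poly. degree P \<le> n \<and> 0 < \<bar>poly (map_poly of_int P) \<xi>\<bar> \<and>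
       \<bar>poly (map_poly of_int P) \<xi>\<bar> \<le> of_int (poly_height P) powr (- w)}}"

definition w_star_exp :: "nat \<Rightarrow> real \<Rightarrow> ereal" where
  "w_star_exp n \<xi> = Sup {ereal w | w :: real.
     infinite {\<alpha> :: real. algebraic \<alpha> \<and> alg_degree \<alpha> \<le> n \<and> 0 < \<bar>\<xi> - \<alpha>\<bar> \<and>
       \<bar>\<xi> - \<alpha>\<bar> \<le> of_int (alg_height \<alpha>) powr (- w - 1)}}"

fun finite_cfrac :: "int list \<Rightarrow> real" where
  "finite_cfrac [] = 0"
| "finite_cfrac [c] = of_int c"
| "finite_cfrac (c # c' # cs) = of_int c + 1 / finite_cfrac (c' # cs)"

definition cfrac_value :: "(nat \<Rightarrow> int) \<Rightarrow> real" where
  "cfrac_value c = lim (\<lambda>n. finite_cfrac (map c [0..<Suc n]))"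

definition a_seq :: "int \<Rightarrow> int \<Rightarrow> real \<Rightarrow> nat \<Rightarrow> int" where
  "a_seq a b w n = (if \<exists>i::nat. int n = \<lfloor>w ^ i\<rfloor> then b else a)"

definition xi :: "int \<Rightarrow> int \<Rightarrow> real \<Rightarrow> real" where
  "xi a b w = cfrac_value (\<lambda>n. if n = 0 then 0 else a_seq a b w n)"

lemma is_int_min_poly_unique:
  assumes "is_int_min_poly \<alpha> P" "is_int_min_poly \<alpha> Q"
  shows "P = Q"
proof -
  have P: "poly (map_poly of_int P) \<alpha> = 0" "content P = 1" "lead_coeff P > 0"
    "\<And>R :: int poly. R \<noteq> 0 \<Longrightarrow> poly (map_poly of_int R) \<alpha> = 0 \<Longrightarrow> degree P \<le> degree R"
    using assms(1) unfolding is_int_min_poly_def by blast+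
  have Q: "poly (map_poly of_int Q) \<alpha> = 0" "content Q = 1" "lead_coeff Q > 0"
    "\<And>R :: int poly. R \<noteq> 0 \<Longrightarrow> poly (map_poly of_int R) \<alpha> = 0 \<Longrightarrow> degree Q \<le> degree R"
    using assms(2) unfolding is_int_min_poly_def by blast+
  have nz: "P \<noteq> 0" "Q \<noteq> 0" using P(3) Q(3) by auto
  have deg: "degree P = degree Q"
    using P(4)[OF nz(2) Q(1)] Q(4)[OF nz(1) P(1)] by simp
  have pos: "degree P > 0"
  proof (rule ccontr)
    assume "\<not> degree P > 0"
    then obtain c where c: "P = [:c:]" by (meson degree_eq_zeroE gr0I)
    then show False using P(1) nz by (simp add: map_poly_pCons)
  qed
  define R where "R = smult (lead_coeff Q) P - smult (lead_coeff P) Q"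
  have map_R: "map_poly real_of_int R =
      smult (of_int (lead_coeff Q)) (map_poly of_int P) -
      smult (of_int (lead_coeff P)) (map_poly of_int Q)"
    by (rule poly_eqI) (simp add: R_def coeff_map_poly)
  have root: "poly (map_poly of_int R) \<alpha> = 0"
    by (simp add: map_R P(1) Q(1))
  have "R = 0"
  proof (rule ccontr)
    assume "R \<noteq> 0"
    then have ge: "degree P \<le> degree R" using P(4) root by blast
    have "degree R \<le> degree P"
      unfolding R_def by (rule degree_diff_le) (use deg in auto)
    with ge have "coeff R (degree P) = lead_coeff R" by simp
    moreover have "coeff R (degree P) = 0"
      by (simp add: R_def deg)
    ultimately show False using \<open>R \<noteq> 0\<close> by simp
  qed
  then have eq: "smult (lead_coeff Q) P = smult (lead_coeff P) Q"
    by (simp add: R_def)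
  from arg_cong[OF this, of content] have "lead_coeff Q = lead_coeff P"
    using P(2,3) Q(2,3) by simp
  with eq nz show ?thesis by (metis smult_eq_iff leading_coeff_0_iff smult_cancel)
qed

lemma is_int_min_poly_int_min_poly:
  assumes "algebraic \<alpha>"
  shows "is_int_min_poly \<alpha> (int_min_poly \<alpha>)"
proof -
  let ?S = "\<lambda>Q :: int poly. Q \<noteq> 0 \<and> poly (map_poly of_int Q) \<alpha> = 0"
  obtain p where p: "\<forall>i. coeff p i \<in> \<int>" "p \<noteq> 0" "poly p \<alpha> = 0"
    using assms unfolding algebraic_def by blast
  have "map_poly real_of_int (map_poly floor p) = p"
    using p(1) by (intro poly_eqI) (auto simp: coeff_map_poly elim: Ints_cases)
  with p have "?S (map_poly floor p)" by auto
  then obtain Q where Q: "?S Q" "\<And>R. ?S R \<Longrightarrow> degree Q \<le> degree R"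
    using ex_has_least_nat[of ?S _ degree] by blast
  define c where "c = sgn (lead_coeff Q) * content Q"
  define P where "P = smult (sgn (lead_coeff Q)) (primitive_part Q)"
  have s: "sgn (lead_coeff Q) = 1 \<or> sgn (lead_coeff Q) = -1"
    using Q(1) by (simp add: sgn_if)
  have "smult c P = Q"
    using s by (auto simp: c_def P_def)
  have c0: "c \<noteq> 0" using Q(1) s by (auto simp: c_def)
  have map_Q: "map_poly real_of_int Q = smult (of_int c) (map_poly of_int P)"
    by (subst \<open>smult c P = Q\<close>[symmetric]) (rule poly_eqI, simp add: coeff_map_poly)
  have "poly (map_poly of_int P) \<alpha> = 0"
    using Q(1) c0 unfolding map_Q by simp
  moreover have "content P = 1"
    using s Q(1) by (auto simp: P_def content_smult)
  moreover have "lead_coeff P > 0"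
  proof -
    have "lead_coeff Q = c * lead_coeff P"
      using \<open>smult c P = Q\<close> by (metis lead_coeff_smult)
    moreover have "content Q > 0" using Q(1) by (simp add: content_def order_less_le)
    ultimately have "content Q * lead_coeff P = \<bar>lead_coeff Q\<bar>"
      using s by (auto simp: c_def abs_sgn)
    also have "\<dots> > 0" using Q(1) by simp
    finally show ?thesis
      using \<open>content Q > 0\<close> by (simp add: zero_less_mult_iff)
  qed
  moreover have "degree P = degree Q"
    using \<open>smult c P = Q\<close> c0 by (metis degree_smult_eq)
  ultimately have "is_int_min_poly \<alpha> P"
    using Q(2) unfolding is_int_min_poly_def by auto
  then show ?thesis
    unfolding int_min_poly_def by (metis theI is_int_min_poly_unique)
qed

end

theory Submission
  imports
    "HOL-Library.Landau_Symbols"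
    "HOL-Real_Asymp.Real_Asymp"
    "Berlekamp_Zassenhaus.Factor_Bound"
    Defs
begin

text \<open>
  Truncating the expansion of \<open>\<xi>\<close> after the \<open>j\<close>-th digit \<open>b\<close> and continuing with the digit \<open>a\<close>
  forever gives a quadratic number \<open>\<alpha>\<^sub>j\<close>. Let \<open>T\<^sub>j\<close> be the height of its minimal polynomial \<open>F\<^sub>j\<close>.
  Then \<open>ln T\<^sub>j\<^sub>+\<^sub>1 \<sim> w ln T\<^sub>j\<close>, and both \<open>|\<xi> - \<alpha>\<^sub>j|\<close> and \<open>|F\<^sub>j(\<xi>)|\<close> are comparable to \<open>1 / T\<^sub>j\<^sub>+\<^sub>1\<close>,
  because the conjugate of \<open>\<alpha>\<^sub>j\<close> is so close to \<open>\<alpha>\<^sub>j\<close> that \<open>F\<^sub>j'(\<alpha>\<^sub>j)\<close> is bounded. This gives both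
  lower bounds.

  Conversely let \<open>P\<close> have degree at most \<open>n\<close> and height \<open>H\<close>. If \<open>P(\<alpha>\<^sub>j) \<noteq> 0\<close>, taking norms shows
  \<open>|P(\<alpha>\<^sub>j)| \<ge> c / (H T\<^sub>j\<^sup>n)\<close>, and for the least \<open>j\<close> with \<open>T\<^sub>j\<^sub>+\<^sub>1 \<ge> C H\<^sup>2 T\<^sub>j\<^sup>n\<close> this is inherited by \<open>P(\<xi>)\<close>.
  For that \<open>j\<close> one has \<open>T\<^sub>j \<lless> H\<^bsup>2w/(w-n)\<^esup>\<close>, up to an arbitrarily small change of the exponent, and
  the hypothesis on \<open>w\<close>, which reads \<open>2 n w \<le> (w - 2) (w - n)\<close> for \<open>n = d\<close>, turns the bound into
  \<open>|P(\<xi>)| \<ggreater> H\<^bsup>-(w-1)-\<eta>\<^esup>\<close>. Factors \<open>F\<^sub>j\<close> of \<open>P\<close> are split off by induction on the degree; they obey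
  the weaker exponent \<open>w\<close>, and the heights of the factors are controlled by
  \<open>H(F) H(R) \<lless> H(F R)\<close>, which follows from the multiplicativity of the Mahler measure. Apart from
  the \<open>\<alpha>\<^sub>j\<close> and their conjugates, an algebraic number of degree at most \<open>n\<close> and height \<open>H\<close> is therefore at
  distance \<open>\<ggreater> H\<^bsup>-w-\<eta>\<^esup>\<close> from \<open>\<xi>\<close>, and these exceptions satisfy the same bound directly.
\<close>

section \<open>Integer polynomials and heights\<close>

abbreviation rpoly :: "int poly \<Rightarrow> real \<Rightarrow> real" where
  "rpoly P x \<equiv> poly (map_poly of_int P) x"

lemma abs_coeff_le_poly_height: "\<bar>coeff P i\<bar> \<le> poly_height P"
proof (cases "i \<le> degree P")
  case True
  then show ?thesis unfolding poly_height_def by (intro Max_ge) auto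
next
  case False
  have "\<bar>coeff P 0\<bar> \<le> poly_height P" unfolding poly_height_def by (intro Max_ge) auto
  with False show ?thesis by (simp add: coeff_eq_0)
qed

lemma poly_height_le_iff: "poly_height P \<le> B \<longleftrightarrow> (\<forall>i. \<bar>coeff P i\<bar> \<le> B)"
proof
  show "\<forall>i. \<bar>coeff P i\<bar> \<le> B" if "poly_height P \<le> B"
    using that abs_coeff_le_poly_height order_trans by blast
  show "poly_height P \<le> B" if "\<forall>i. \<bar>coeff P i\<bar> \<le> B"
    unfolding poly_height_def using that by (intro Max.boundedI) auto
qed

lemma poly_height_attained: "\<exists>i. poly_height P = \<bar>coeff P i\<bar>"
  using Max_in[of "(\<lambda>i. \<bar>coeff P i\<bar>) ` {..degree P}"] unfolding poly_height_def by blast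

lemma poly_height_ge_1:
  assumes "P \<noteq> 0"
  shows "poly_height P \<ge> 1"
  using abs_coeff_le_poly_height[of P "degree P"] assms
  by (smt (verit) leading_coeff_0_iff)

lemma poly_height_nonneg: "poly_height P \<ge> 0"
  using abs_coeff_le_poly_height[of P 0] by linarith

lemma poly_height_le_if_linear_factors:
  fixes u v u' v' :: real
  assumes "map_poly of_int P = [:- u, v:] * [:- u', v':]"
    and "\<bar>u\<bar> \<le> X" "\<bar>v\<bar> \<le> X" "\<bar>u'\<bar> \<le> X" "\<bar>v'\<bar> \<le> X"
  shows "of_int (poly_height P) \<le> 2 * X\<^sup>2"
proof -
  obtain i where i: "poly_height P = \<bar>coeff P i\<bar>" using poly_height_attained by blast
  have "X \<ge> 0" using assms(2) by linarith
  have product: "\<bar>x * y\<bar> \<le> X\<^sup>2" if "\<bar>x\<bar> \<le> X" "\<bar>y\<bar> \<le> X" for x y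
    unfolding abs_mult power2_eq_square using that \<open>X \<ge> 0\<close> by (intro mult_mono) auto
  have "of_int (coeff P i) = coeff ([:- u, v:] * [:- u', v':]) i"
    unfolding assms(1)[symmetric] by simp
  also have "[:- u, v:] * [:- u', v':] = [:u * u', - (u * v' + v * u'), v * v':]"
    by (simp add: algebra_simps)
  also have "\<bar>coeff \<dots> i\<bar> \<le> 2 * X\<^sup>2"
    using product[OF assms(2,4)] product[OF assms(3,5)] product[OF assms(2,5)]
      product[OF assms(3,4)]
    by (auto simp: coeff_pCons split: nat.split)
  finally show ?thesis by (simp add: i)
qed

lemma abs_of_int_coeff_le_poly_height: "\<bar>real_of_int (coeff P i)\<bar> \<le> of_int (poly_height P)"
  using abs_coeff_le_poly_height[of P i] by linarith

lemma finite_int_poly_bounded_height: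
  "finite {P :: int poly. degree P \<le> n \<and> poly_height P \<le> B}"
proof -
  have "{P :: int poly. degree P \<le> n \<and> poly_height P \<le> B}
      \<subseteq> Poly ` {xs. set xs \<subseteq> {-B..B} \<and> length xs = Suc n}"
  proof safe
    fix P :: "int poly" assume "degree P \<le> n" "poly_height P \<le> B"
    then have "P = Poly (map (coeff P) [0..<Suc n])"
      by (intro poly_eqI) (auto simp: nth_default_def coeff_eq_0 simp del: upt_Suc)
    moreover have "coeff P i \<in> {-B..B}" for i
      using \<open>poly_height P \<le> B\<close> by (auto simp: poly_height_le_iff abs_le_iff minus_le_iff)
    ultimately show "P \<in> Poly ` {xs. set xs \<subseteq> {-B..B} \<and> length xs = Suc n}"
      by (intro image_eqI[where x = "map (coeff P) [0..<Suc n]"]) auto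
  qed
  then show ?thesis
    by (rule finite_subset) (intro finite_imageI finite_lists_length_eq, simp)
qed

lemma abs_rpoly_le:
  assumes "degree P \<le> n" "\<bar>x\<bar> \<le> R" "1 \<le> R"
  shows "\<bar>rpoly P x\<bar> \<le> (real n + 1) * R ^ n * of_int (poly_height P)"
proof -
  have "\<bar>rpoly P x\<bar> = \<bar>\<Sum>i\<le>degree P. of_int (coeff P i) * x ^ i\<bar>"
    by (simp add: poly_altdef)
  also have "\<dots> \<le> (\<Sum>i\<le>degree P. of_int (poly_height P) * R ^ n)"
  proof (rule order_trans[OF sum_abs], rule sum_mono)
    fix i assume "i \<in> {..degree P}"
    then have "\<bar>x\<bar> ^ i \<le> R ^ n"
      using assms by (intro order_trans[OF power_mono power_increasing]) auto
    then show "\<bar>of_int (coeff P i) * x ^ i\<bar> \<le> of_int (poly_height P) * R ^ n"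
      unfolding abs_mult power_abs by (intro mult_mono abs_of_int_coeff_le_poly_height)
        (auto simp: poly_height_nonneg)
  qed
  also have "\<dots> = (real (degree P) + 1) * (R ^ n * of_int (poly_height P))" by simp
  also have "\<dots> \<le> (real n + 1) * (R ^ n * of_int (poly_height P))"
    using assms by (intro mult_right_mono) (auto simp: poly_height_nonneg)
  finally show ?thesis by (simp only: mult.assoc)
qed

lemma poly_height_pderiv_le:
  assumes "degree P \<le> n"
  shows "poly_height (pderiv P) \<le> int n * poly_height P"
  unfolding poly_height_le_iff
proof
  fix i
  show "\<bar>coeff (pderiv P) i\<bar> \<le> int n * poly_height P"
  proof (cases "Suc i \<le> n")
    case True
    then show ?thesis
      unfolding coeff_pderiv abs_mult by (intro mult_mono abs_coeff_le_poly_height) auto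
  next
    case False
    then show ?thesis using assms by (simp add: coeff_pderiv coeff_eq_0 poly_height_nonneg)
  qed
qed

lemma rpoly_lipschitz:
  assumes "degree P \<le> n" "\<bar>x\<bar> \<le> R" "\<bar>y\<bar> \<le> R" "1 \<le> R"
  shows "\<bar>rpoly P x - rpoly P y\<bar> \<le> (real n + 1) * R ^ n * real n * of_int (poly_height P) * \<bar>x - y\<bar>"
  using assms(2,3)
proof (induction x y rule: linorder_less_wlog)
  case (less x y)
  obtain z where z: "x < z" "z < y"
    "rpoly P y - rpoly P x = (y - x) * poly (pderiv (map_poly of_int P)) z"
    using poly_MVT[OF less(1), of "map_poly of_int P"] by blast
  have "\<bar>z\<bar> \<le> R" using z less by linarith
  have "\<bar>rpoly (pderiv P) z\<bar> \<le> (real n + 1) * R ^ n * of_int (poly_height (pderiv P))"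
    using assms(1,4) \<open>\<bar>z\<bar> \<le> R\<close> by (intro abs_rpoly_le) (auto simp: degree_pderiv)
  also have "\<dots> \<le> (real n + 1) * R ^ n * of_int (int n * poly_height P)"
    using assms by (intro mult_left_mono) (auto intro: poly_height_pderiv_le simp del: of_int_mult)
  finally have "\<bar>y - x\<bar> * \<bar>rpoly (pderiv P) z\<bar>
      \<le> \<bar>y - x\<bar> * ((real n + 1) * R ^ n * of_int (int n * poly_height P))"
    by (intro mult_left_mono) auto
  then show ?case
    unfolding abs_minus_commute[of "rpoly P x"] abs_minus_commute[of x] z(3) abs_mult
      of_int_hom.map_poly_pderiv[symmetric] by (simp add: mult_ac)
next
  case (sym x y)
  then show ?case by (simp add: abs_minus_commute)
qed simp

lemma poly_height_le_mahler_measure: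
  "of_int (poly_height P) \<le> 2 ^ degree P * mahler_measure P"
proof -
  obtain i where i: "poly_height P = \<bar>coeff P i\<bar>" using poly_height_attained by blast
  have "of_int (poly_height P) \<le> (degree P choose i) * mahler_measure P"
    unfolding i by (rule Mignotte_bound)
  also have "\<dots> \<le> 2 ^ degree P * mahler_measure P"
    using of_nat_mono[OF binomial_le_pow2[of "degree P" i], where ?'a = real]
    by (intro mult_right_mono mahler_measure_ge_0) simp
  finally show ?thesis .
qed

lemma mahler_measure_le_poly_height:
  "mahler_measure P \<le> (real (degree P) + 1) * of_int (poly_height P)"
proof -
  let ?H = "real_of_int (poly_height P)"
  have "mahler_measure P \<le> sqrt (\<Sum>a\<leftarrow>coeffs (map_poly complex_of_int P). (cmod a)\<^sup>2)"
    unfolding mahler_measure_def by (rule Landau_inequality)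
  also have "(\<Sum>a\<leftarrow>coeffs (map_poly complex_of_int P). (cmod a)\<^sup>2)
      = (\<Sum>a\<leftarrow>coeffs P. (real_of_int a)\<^sup>2)"
    by (simp add: of_int_hom.coeffs_map_poly_hom comp_def)
  also have "sqrt \<dots> \<le> sqrt (\<Sum>a\<leftarrow>coeffs P. ?H\<^sup>2)"
  proof (rule real_sqrt_le_mono, rule sum_list_mono)
    fix a assume "a \<in> set (coeffs P)"
    then obtain i where "a = coeff P i" by (auto simp: coeffs_def split: if_splits)
    then show "(real_of_int a)\<^sup>2 \<le> ?H\<^sup>2"
      using power_mono[OF abs_of_int_coeff_le_poly_height[of P i], of 2] by simp
  qed
  also have "\<dots> = sqrt (length (coeffs P)) * ?H"
    by (simp add: sum_list_triv real_sqrt_mult poly_height_nonneg)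
  also have "\<dots> \<le> (real (degree P) + 1) * ?H"
  proof (intro mult_right_mono real_le_lsqrt)
    have "length (coeffs P) \<le> degree P + 1" by (simp add: coeffs_def)
    then have "real (length (coeffs P)) \<le> real (degree P) + 1" by linarith
    also have "\<dots> \<le> (real (degree P) + 1)\<^sup>2" by (rule self_le_power) auto
    finally show "real (length (coeffs P)) \<le> (real (degree P) + 1)\<^sup>2" .
  qed (auto simp: poly_height_nonneg)
  finally show ?thesis .
qed

lemma poly_height_mult_ge:
  "of_int (poly_height P) * of_int (poly_height Q)
    \<le> 2 ^ (degree P + degree Q) * (real (degree (P * Q)) + 1) * of_int (poly_height (P * Q))"
proof -
  have "of_int (poly_height P) * of_int (poly_height Q)
      \<le> (2 ^ degree P * mahler_measure P) * (2 ^ degree Q * mahler_measure Q)"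
    by (intro mult_mono poly_height_le_mahler_measure)
      (auto simp: poly_height_nonneg mahler_measure_ge_0)
  also have "\<dots> = 2 ^ (degree P + degree Q) * mahler_measure (P * Q)"
    by (simp add: mahler_measure_def of_int_poly_hom.hom_mult measure_eq_prod power_add)
  also have "\<dots> \<le> 2 ^ (degree P + degree Q) *
      ((real (degree (P * Q)) + 1) * of_int (poly_height (P * Q)))"
    by (intro mult_left_mono mahler_measure_le_poly_height) auto
  finally show ?thesis by (simp only: mult.assoc)
qed

lemma powr_poly_height_mult_le:
  assumes "P * Q \<noteq> 0" "degree P + degree Q \<le> m" "s \<ge> 0"
  defines "D \<equiv> 2 ^ m * (real m + 1)"
  shows "D powr - s * of_int (poly_height (P * Q)) powr - s
    \<le> of_int (poly_height P) powr - s * of_int (poly_height Q) powr - s"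
proof -
  have "P \<noteq> 0" "Q \<noteq> 0" using assms(1) by auto
  have H_pos: "real_of_int (poly_height P) > 0" "real_of_int (poly_height Q) > 0"
    "real_of_int (poly_height (P * Q)) > 0"
    using poly_height_ge_1[OF assms(1)] poly_height_ge_1[OF \<open>P \<noteq> 0\<close>] poly_height_ge_1[OF \<open>Q \<noteq> 0\<close>]
    by linarith+
  have "real_of_int (poly_height P) * of_int (poly_height Q)
      \<le> 2 ^ (degree P + degree Q) * (real (degree (P * Q)) + 1) * of_int (poly_height (P * Q))"
    by (rule poly_height_mult_ge)
  also have "\<dots> \<le> D * of_int (poly_height (P * Q))"
    unfolding D_def using assms(2) H_pos(3)
    by (intro mult_right_mono mult_mono power_increasing)
      (auto simp: degree_mult_eq \<open>P \<noteq> 0\<close> \<open>Q \<noteq> 0\<close>)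
  finally have "(D * of_int (poly_height (P * Q))) powr - s
      \<le> (real_of_int (poly_height P) * of_int (poly_height Q)) powr - s"
    using H_pos assms(3) by (intro powr_mono2') auto
  then show ?thesis using H_pos by (simp add: powr_mult D_def)
qed

section \<open>Minimal polynomials\<close>

lemma is_int_min_polyD:
  assumes "is_int_min_poly \<alpha> P"
  shows "rpoly P \<alpha> = 0" "Polynomial.content P = 1" "lead_coeff P > 0" "P \<noteq> 0" "degree P > 0"
    and "Q \<noteq> 0 \<Longrightarrow> rpoly Q \<alpha> = 0 \<Longrightarrow> degree P \<le> degree Q"
proof -
  show root: "rpoly P \<alpha> = 0" and "Polynomial.content P = 1" and "lead_coeff P > 0"
    and "Q \<noteq> 0 \<Longrightarrow> rpoly Q \<alpha> = 0 \<Longrightarrow> degree P \<le> degree Q"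
    using assms unfolding is_int_min_poly_def by blast+
  then show "P \<noteq> 0" by auto
  then show "degree P > 0"
    using root by (cases "degree P = 0")
      (auto elim!: degree_eq_zeroE simp: of_int_hom.map_poly_pCons_hom)
qed

lemma is_int_min_poly_eq_int_min_poly:
  assumes "is_int_min_poly \<alpha> P"
  shows "algebraic \<alpha>" "int_min_poly \<alpha> = P"
proof -
  show "int_min_poly \<alpha> = P"
    unfolding int_min_poly_def using assms is_int_min_poly_unique by blast
  show "algebraic \<alpha>"
    unfolding algebraic_def
    by (rule exI[of _ "map_poly of_int P"])
      (use is_int_min_polyD[OF assms] in \<open>auto simp: coeff_map_poly\<close>)
qed

lemma is_int_min_poly_quadratic:
  assumes "rpoly P x = 0" "degree P = 2" "Polynomial.content P = 1" "lead_coeff P > 0" "x \<notin> \<rat>"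
  shows "is_int_min_poly x P"
  unfolding is_int_min_poly_def
proof (intro conjI allI impI assms)
  fix Q :: "int poly" assume Q: "Q \<noteq> 0" "rpoly Q x = 0"
  show "degree P \<le> degree Q"
  proof (rule ccontr)
    assume "\<not> degree P \<le> degree Q"
    then have "degree Q \<le> 1" using assms(2) by simp
    then have "Q = [:coeff Q 0, coeff Q 1:]"
      by (intro poly_eqI) (auto simp: coeff_pCons coeff_eq_0 split: nat.split)
    then obtain u v where Q_eq: "Q = [:u, v:]" by blast
    then have root: "of_int u + x * of_int v = 0"
      using Q(2) by (simp add: of_int_hom.map_poly_pCons_hom)
    show False
    proof (cases "v = 0")
      case True
      then show False using root Q(1) Q_eq by simp
    next
      case False
      then have "x = of_int (- u) / of_int v" using root by (simp add: field_simps)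
      then show False using assms(5) by (metis Rats_divide Rats_of_int)
    qed
  qed
qed

lemma is_int_min_poly_dvd_iff:
  assumes "is_int_min_poly \<alpha> Q"
  shows "Q dvd P \<longleftrightarrow> rpoly P \<alpha> = 0"
proof
  assume "rpoly P \<alpha> = 0"
  note Q = is_int_min_polyD[OF assms]
  obtain q r where qr: "pseudo_divmod P Q = (q, r)" by force
  define c where "c = lead_coeff Q ^ (Suc (degree P) - degree Q)"
  have eq: "smult c P = Q * q + r" and r: "r = 0 \<or> degree r < degree Q"
    using pseudo_divmod[OF Q(4) qr] by (auto simp: c_def)
  have "c > 0" using Q(3) by (simp add: c_def)
  have "rpoly r \<alpha> = 0"
    using arg_cong[OF eq, of "\<lambda>p. rpoly p \<alpha>"] \<open>rpoly P \<alpha> = 0\<close> Q(1)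
    by (simp add: of_int_poly_hom.hom_mult of_int_poly_hom.hom_add of_int_hom.map_poly_hom_smult)
  then have "r = 0" using r Q(6)[of r] by force
  with eq have smult_P: "smult c P = Q * q" by simp
  from arg_cong[OF this, of Polynomial.content]
    have "Polynomial.content q = c * Polynomial.content P"
    using Q(2) \<open>c > 0\<close> by (simp add: content_mult)
  then have "q = smult (c * Polynomial.content P) (primitive_part q)"
    by (metis content_times_primitive_part)
  then have "smult c P = smult c (Q * smult (Polynomial.content P) (primitive_part q))"
    using smult_P by (metis mult_smult_right smult_smult)
  then have "P = Q * smult (Polynomial.content P) (primitive_part q)"
    using \<open>c > 0\<close> by (metis smult_cancel less_numeral_extra(3))
  then show "Q dvd P" by (metis dvd_triv_left)
next
  show "rpoly P \<alpha> = 0" if "Q dvd P"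
    using that is_int_min_polyD(1)[OF assms] by (auto simp: of_int_poly_hom.hom_mult)
qed

lemma is_int_min_poly_conjugate:
  assumes "is_int_min_poly \<alpha> P" "rpoly P \<beta> = 0"
  shows "is_int_min_poly \<beta> P"
proof -
  note P = is_int_min_polyD[OF assms(1)]
  have "degree P \<le> degree Q" if "Q \<noteq> 0" "rpoly Q \<beta> = 0" for Q
  proof -
    have "algebraic \<beta>"
      unfolding algebraic_def
      by (rule exI[of _ "map_poly of_int P"]) (use assms P in \<open>auto simp: coeff_map_poly\<close>)
    then have M: "is_int_min_poly \<beta> (int_min_poly \<beta>)" by (rule is_int_min_poly_int_min_poly)
    then obtain R where R: "P = int_min_poly \<beta> * R"
      using is_int_min_poly_dvd_iff assms(2) by (metis dvdE)
    with P have "int_min_poly \<beta> \<noteq> 0" "R \<noteq> 0" by auto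
    then have "degree P = degree (int_min_poly \<beta>) + degree R" by (simp add: R degree_mult_eq)
    moreover have "rpoly (int_min_poly \<beta>) \<alpha> * rpoly R \<alpha> = 0"
      using P(1) by (simp add: R of_int_poly_hom.hom_mult)
    ultimately have "degree P \<le> degree (int_min_poly \<beta>)"
      using P(6)[of "int_min_poly \<beta>"] P(6)[of R] is_int_min_polyD(5)[OF M]
        \<open>int_min_poly \<beta> \<noteq> 0\<close> \<open>R \<noteq> 0\<close> by auto
    then show ?thesis using is_int_min_polyD(6)[OF M that] by linarith
  qed
  then show ?thesis using assms(2) P unfolding is_int_min_poly_def by blast
qed

lemma alg_height_ge_1:
  assumes "algebraic \<alpha>"
  shows "alg_height \<alpha> \<ge> 1"
  unfolding alg_height_def
  using is_int_min_polyD(4)[OF is_int_min_poly_int_min_poly[OF assms]] by (rule poly_height_ge_1)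

lemma finite_algebraic_bounded_height:
  "finite {\<alpha> :: real. algebraic \<alpha> \<and> alg_degree \<alpha> \<le> n \<and> alg_height \<alpha> \<le> B}"
proof (rule finite_subset)
  let ?polys = "{P :: int poly. degree P \<le> n \<and> poly_height P \<le> B} - {0}"
  show "{\<alpha> :: real. algebraic \<alpha> \<and> alg_degree \<alpha> \<le> n \<and> alg_height \<alpha> \<le> B}
      \<subseteq> (\<Union>P\<in>?polys. {x. rpoly P x = 0})"
  proof safe
    fix \<alpha> :: real assume "algebraic \<alpha>" "alg_degree \<alpha> \<le> n" "alg_height \<alpha> \<le> B"
    then show "\<alpha> \<in> (\<Union>P\<in>?polys. {x. rpoly P x = 0})"
      using is_int_min_polyD(1,4)[OF is_int_min_poly_int_min_poly]
      by (intro UN_I[of "int_min_poly \<alpha>"]) (simp_all add: alg_degree_def alg_height_def)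
  qed
  show "finite (\<Union>P\<in>?polys. {x. rpoly P x = 0})"
    by (intro finite_UN_I finite_Diff finite_int_poly_bounded_height poly_roots_finite) auto
qed

subsection \<open>Liouville's inequality for quadratic numbers\<close>

lemma quadratic_poly_conjugate:
  fixes F :: "int poly"
  assumes "degree F = 2" "rpoly F \<alpha> = 0"
  obtains \<beta> where "\<And>x. rpoly F x = of_int (lead_coeff F) * (x - \<alpha>) * (x - \<beta>)"
    "of_int (coeff F 1) = - of_int (lead_coeff F) * (\<alpha> + \<beta>)"
    "of_int (coeff F 0) = of_int (lead_coeff F) * \<alpha> * \<beta>"
proof -
  define a b c where "a = real_of_int (coeff F 2)" and "b = real_of_int (coeff F 1)"
    and "c = real_of_int (coeff F 0)"
  define \<beta> where "\<beta> = - b / a - \<alpha>"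
  have "a \<noteq> 0"
    using assms(1) by (metis a_def degree_0 leading_coeff_0_iff of_int_eq_0_iff zero_neq_numeral)
  then have b: "b = - a * (\<alpha> + \<beta>)" by (simp add: \<beta>_def)
  have F: "rpoly F x = a * x\<^sup>2 + b * x + c" for x
    by (simp add: poly_altdef assms(1) a_def b_def c_def numeral_2_eq_2)
  have "a * \<alpha>\<^sup>2 + b * \<alpha> + c = 0" using assms(2) F by simp
  then have c: "c = a * \<alpha> * \<beta>" unfolding b by (simp add: algebra_simps power2_eq_square)
  have "rpoly F x = a * (x - \<alpha>) * (x - \<beta>)" for x
    unfolding F b c by (simp add: algebra_simps power2_eq_square)
  moreover have "a = of_int (lead_coeff F)" by (simp add: a_def assms(1))
  ultimately show ?thesis using b c unfolding b_def c_def by (intro that[of \<beta>]) simp_all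
qed

lemma scaled_power_sum_in_Ints:
  fixes a \<alpha> \<beta> :: real
  assumes "a \<in> \<int>" "a * (\<alpha> + \<beta>) \<in> \<int>" "a * \<alpha> * \<beta> \<in> \<int>" "k \<le> n"
  shows "a ^ n * (\<alpha> ^ k + \<beta> ^ k) \<in> \<int>"
proof -
  have "a ^ k * (\<alpha> ^ k + \<beta> ^ k) \<in> \<int>"
  proof (induction k rule: induct_nat_012)
    case (ge2 k)
    have "a ^ Suc (Suc k) * (\<alpha> ^ Suc (Suc k) + \<beta> ^ Suc (Suc k))
        = a * (\<alpha> + \<beta>) * (a ^ Suc k * (\<alpha> ^ Suc k + \<beta> ^ Suc k))
          - a * (a * \<alpha> * \<beta>) * (a ^ k * (\<alpha> ^ k + \<beta> ^ k))"
      by (simp add: algebra_simps)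
    also have "\<dots> \<in> \<int>"
      by (rule Ints_diff[OF Ints_mult[OF assms(2) ge2(2)]
            Ints_mult[OF Ints_mult[OF assms(1,3)] ge2(1)]])
    finally show ?case .
  qed (use assms in auto)
  then have "a ^ (n - k) * (a ^ k * (\<alpha> ^ k + \<beta> ^ k)) \<in> \<int>"
    by (rule Ints_mult[OF Ints_power[OF assms(1)]])
  then show ?thesis using assms(4) by (simp flip: power_add mult.assoc)
qed

lemma scaled_quadratic_norm_in_Ints:
  fixes a \<alpha> \<beta> :: real
  assumes "a \<in> \<int>" "a * (\<alpha> + \<beta>) \<in> \<int>" "a * \<alpha> * \<beta> \<in> \<int>" "degree P \<le> n"
  shows "a ^ n * (rpoly P \<alpha> * rpoly P \<beta>) \<in> \<int>"
  using assms(4)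
proof (induction P arbitrary: n)
  case 0
  then show ?case by simp
next
  case (pCons c P)
  show ?case
  proof (cases "P = 0")
    case True
    then show ?thesis using assms(1) by (auto simp: of_int_hom.map_poly_pCons_hom)
  next
    case False
    then obtain m where m: "n = Suc m" "degree P \<le> m" using pCons.prems by (cases n) auto
    have "a ^ n * (\<alpha> * rpoly P \<alpha> + \<beta> * rpoly P \<beta>)
        = (\<Sum>i\<le>degree P. of_int (coeff P i) * (a ^ n * (\<alpha> ^ Suc i + \<beta> ^ Suc i)))"
      by (simp add: poly_altdef sum_distrib_left sum.distrib algebra_simps)
    also have "\<dots> \<in> \<int>"
      using m by (intro Ints_sum Ints_mult scaled_power_sum_in_Ints assms(1-3)) auto
    finally have trace: "a ^ n * (\<alpha> * rpoly P \<alpha> + \<beta> * rpoly P \<beta>) \<in> \<int>" .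
    have "a ^ n * (rpoly (pCons c P) \<alpha> * rpoly (pCons c P) \<beta>)
        = of_int (c * c) * a ^ n + of_int c * (a ^ n * (\<alpha> * rpoly P \<alpha> + \<beta> * rpoly P \<beta>))
          + a * \<alpha> * \<beta> * (a ^ m * (rpoly P \<alpha> * rpoly P \<beta>))"
      by (simp add: of_int_hom.map_poly_pCons_hom m(1) algebra_simps)
    also have "\<dots> \<in> \<int>"
      by (rule Ints_add[OF Ints_add[OF Ints_mult[OF Ints_of_int Ints_power[OF assms(1)]]
            Ints_mult[OF Ints_of_int trace]] Ints_mult[OF assms(3) pCons.IH[OF m(2)]]])
    finally show ?thesis .
  qed
qed

lemma lead_coeff_mult_conjugate_le:
  fixes F :: "int poly"
  defines "a \<equiv> real_of_int (lead_coeff F)" and "H \<equiv> real_of_int (poly_height F)"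
  assumes "a > 0" "of_int (coeff F 1) = - a * (\<alpha> + \<beta>)"
  shows "a * max 1 \<bar>\<beta>\<bar> \<le> (1 + \<bar>\<alpha>\<bar>) * H"
proof -
  have "a \<le> H" using abs_of_int_coeff_le_poly_height[of F "degree F"] by (simp add: a_def H_def)
  have "a * \<beta> = - of_int (coeff F 1) + a * (- \<alpha>)" using assms(4) by (simp add: algebra_simps)
  then have "\<bar>a * \<beta>\<bar> \<le> \<bar>of_int (coeff F 1)\<bar> + \<bar>a * (- \<alpha>)\<bar>"
    using abs_triangle_ineq[of "- of_int (coeff F 1)" "a * (- \<alpha>)"] by simp
  then have "a * \<bar>\<beta>\<bar> \<le> \<bar>of_int (coeff F 1)\<bar> + a * \<bar>\<alpha>\<bar>" using \<open>a > 0\<close> by (simp add: abs_mult)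
  also have "\<dots> \<le> H + H * \<bar>\<alpha>\<bar>"
    using \<open>a \<le> H\<close>
    by (intro add_mono mult_right_mono) (auto simp: H_def abs_of_int_coeff_le_poly_height)
  finally have "a * \<bar>\<beta>\<bar> \<le> (1 + \<bar>\<alpha>\<bar>) * H" by (simp add: algebra_simps)
  moreover have "1 * H \<le> (1 + \<bar>\<alpha>\<bar>) * H" using \<open>a \<le> H\<close> \<open>a > 0\<close> by (intro mult_right_mono) auto
  ultimately show ?thesis using \<open>a \<le> H\<close> by (simp add: max_def)
qed

lemma quadratic_liouville:
  assumes F: "is_int_min_poly \<alpha> F" "degree F = 2" and P: "degree P \<le> n" "rpoly P \<alpha> \<noteq> 0"
  shows "1 \<le> (real n + 1) * (1 + \<bar>\<alpha>\<bar>) ^ n * of_int (poly_height F) ^ n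
    * of_int (poly_height P) * \<bar>rpoly P \<alpha>\<bar>"
proof -
  define a where "a = real_of_int (lead_coeff F)"
  define H where "H = real_of_int (poly_height F)"
  obtain \<beta> where \<beta>: "\<And>x. rpoly F x = a * (x - \<alpha>) * (x - \<beta>)"
    and coeff_1: "of_int (coeff F 1) = - a * (\<alpha> + \<beta>)" and coeff_0: "of_int (coeff F 0) = a * \<alpha> * \<beta>"
    by (rule quadratic_poly_conjugate[OF F(2) is_int_min_polyD(1)[OF F(1)], folded a_def])
      (rule that)
  have "a > 0" using is_int_min_polyD(3)[OF F(1)] by (simp add: a_def)
  have "rpoly F \<beta> = 0" by (simp add: \<beta>)
  then have "is_int_min_poly \<beta> F" by (rule is_int_min_poly_conjugate[OF F(1)])
  then have "rpoly P \<beta> \<noteq> 0"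
    using P(2) is_int_min_poly_dvd_iff[OF F(1)] is_int_min_poly_dvd_iff by metis
  have "a * (\<alpha> + \<beta>) = of_int (- coeff F 1)" "a * \<alpha> * \<beta> = of_int (coeff F 0)"
    using coeff_1 coeff_0 by simp_all
  then have "a ^ n * (rpoly P \<alpha> * rpoly P \<beta>) \<in> \<int>"
    by (intro scaled_quadratic_norm_in_Ints P(1)) (auto simp: a_def)
  then have "1 \<le> \<bar>a ^ n * (rpoly P \<alpha> * rpoly P \<beta>)\<bar>"
    using P(2) \<open>rpoly P \<beta> \<noteq> 0\<close> \<open>a > 0\<close> by (intro Ints_nonzero_abs_ge1) auto
  then have norm: "1 \<le> a ^ n * \<bar>rpoly P \<beta>\<bar> * \<bar>rpoly P \<alpha>\<bar>"
    using \<open>a > 0\<close> by (simp add: abs_mult mult_ac)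
  have conjugate_bound: "a * max 1 \<bar>\<beta>\<bar> \<le> (1 + \<bar>\<alpha>\<bar>) * H"
    unfolding a_def H_def using coeff_1 \<open>a > 0\<close>
    by (intro lead_coeff_mult_conjugate_le) (auto simp: a_def)
  have "a ^ n * \<bar>rpoly P \<beta>\<bar> \<le> a ^ n * ((real n + 1) * max 1 \<bar>\<beta>\<bar> ^ n * of_int (poly_height P))"
    using P(1) \<open>a > 0\<close> by (intro mult_left_mono abs_rpoly_le) auto
  also have "\<dots> = (real n + 1) * (a * max 1 \<bar>\<beta>\<bar>) ^ n * of_int (poly_height P)"
    by (simp add: power_mult_distrib)
  also have "\<dots> \<le> (real n + 1) * ((1 + \<bar>\<alpha>\<bar>) * H) ^ n * of_int (poly_height P)"
    using conjugate_bound \<open>a > 0\<close>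
    by (intro mult_right_mono mult_left_mono power_mono) (auto simp: poly_height_nonneg)
  finally have "a ^ n * \<bar>rpoly P \<beta>\<bar> * \<bar>rpoly P \<alpha>\<bar>
      \<le> (real n + 1) * ((1 + \<bar>\<alpha>\<bar>) * H) ^ n * of_int (poly_height P) * \<bar>rpoly P \<alpha>\<bar>"
    by (rule mult_right_mono) simp
  then show ?thesis using norm by (simp add: H_def power_mult_distrib mult_ac)
qed

section \<open>Uniform estimates\<close>

text \<open>\<open>f \<in> \<Omega>[principal S](g)\<close> expresses \<open>|f x| \<ge> c |g x|\<close> for all \<open>x \<in> S\<close>, with a constant
  \<open>c > 0\<close> that does not depend on \<open>x\<close>; similarly for \<open>O\<close> and \<open>\<Theta>\<close>.\<close>

lemma bigomega_principalI:
  fixes f g :: "'a \<Rightarrow> real"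
  assumes "c > 0" "\<And>x. x \<in> S \<Longrightarrow> c * \<bar>g x\<bar> \<le> \<bar>f x\<bar>"
  shows "f \<in> \<Omega>[principal S](g)"
  using assms by (intro landau_omega.bigI[of c]) (simp_all add: eventually_principal)

lemma bigomega_union:
  fixes f :: "'a \<Rightarrow> real"
  assumes "f \<in> \<Omega>[principal A](g)" "f \<in> \<Omega>[principal B](g)" "S \<subseteq> A \<union> B"
  shows "f \<in> \<Omega>[principal S](g)"
  using landau_omega.big.sup[OF assms(1,2)] assms(3) by (auto intro: landau_omega.big.filter_mono)

lemma bigtheta_divide_principal:
  fixes f g :: "'a \<Rightarrow> real"
  assumes "f \<in> \<Theta>[principal S](f')" "g \<in> \<Theta>[principal S](g')"
  shows "(\<lambda>x. f x / g x) \<in> \<Theta>[principal S](\<lambda>x. f' x / g' x)"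
  unfolding divide_inverse by (intro landau_theta.mult assms iffD2[OF bigtheta_inverse])

lemma bigo_principal_UNIV_if_sequentially:
  fixes f g :: "nat \<Rightarrow> real"
  assumes "f \<in> O(g)" "\<And>n. g n \<noteq> 0"
  shows "f \<in> O[principal UNIV](g)"
proof -
  obtain c N where "c > 0" and c: "\<And>n. n \<ge> N \<Longrightarrow> \<bar>f n\<bar> \<le> c * \<bar>g n\<bar>"
    using assms(1) by (elim landau_o.bigE) (auto simp: eventually_at_top_linorder)
  define C where "C = c + (\<Sum>n<N. \<bar>f n / g n\<bar>)"
  have "\<bar>f n\<bar> \<le> C * \<bar>g n\<bar>" for n
  proof (cases "n < N")
    case True
    then have "\<bar>f n / g n\<bar> \<le> (\<Sum>n<N. \<bar>f n / g n\<bar>)" by (intro member_le_sum) auto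
    then have "\<bar>f n / g n\<bar> * \<bar>g n\<bar> \<le> C * \<bar>g n\<bar>"
      using \<open>c > 0\<close> by (intro mult_right_mono) (auto simp: C_def)
    then show ?thesis using assms(2) by (simp add: abs_divide)
  next
    case False
    then have "\<bar>f n\<bar> \<le> c * \<bar>g n\<bar>" by (intro c) auto
    also have "\<dots> \<le> C * \<bar>g n\<bar>" by (intro mult_right_mono) (auto simp: C_def sum_nonneg)
    finally show ?thesis .
  qed
  then show ?thesis by (intro bigoI[of _ C]) auto
qed

lemma bigo_principal_UNIV_if_ln_le:
  fixes f g :: "nat \<Rightarrow> real"
  assumes "eventually (\<lambda>j. ln (f j) \<le> ln (g j)) sequentially" "\<And>j. f j > 0" "\<And>j. g j > 0"
  shows "f \<in> O[principal UNIV](g)"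
proof (rule bigo_principal_UNIV_if_sequentially)
  have "eventually (\<lambda>j. norm (f j) \<le> 1 * norm (g j)) sequentially"
    using assms(1) by eventually_elim (use assms(2,3) in \<open>simp add: less_imp_le\<close>)
  then show "f \<in> O(g)" by (rule bigoI)
qed (use assms(3) in \<open>simp add: less_imp_neq[symmetric]\<close>)

lemma bigtheta_ln_diff_bounded:
  fixes f g :: "'a \<Rightarrow> real"
  assumes "f \<in> \<Theta>[principal S](g)" and pos: "\<And>x. x \<in> S \<Longrightarrow> f x > 0" "\<And>x. x \<in> S \<Longrightarrow> g x > 0"
  shows "\<exists>E. \<forall>x\<in>S. \<bar>ln (f x) - ln (g x)\<bar> \<le> E"
proof -
  obtain k where "k > 0" and k: "\<forall>x\<in>S. \<bar>f x\<bar> \<le> k * \<bar>g x\<bar>"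
    using bigthetaD1[OF assms(1)] by (elim landau_o.bigE) (simp add: eventually_principal)
  obtain l where "l > 0" and l: "\<forall>x\<in>S. l * \<bar>g x\<bar> \<le> \<bar>f x\<bar>"
    using bigthetaD2[OF assms(1)] by (elim landau_omega.bigE) (simp add: eventually_principal)
  have "\<bar>ln (f x) - ln (g x)\<bar> \<le> \<bar>ln k\<bar> + \<bar>ln l\<bar>" if "x \<in> S" for x
  proof -
    have "f x > 0" "g x > 0" "f x \<le> k * g x" "l * g x \<le> f x" using pos[OF that] k l that by auto
    then have "ln (f x) \<le> ln (k * g x)" "ln (l * g x) \<le> ln (f x)" using \<open>k > 0\<close> \<open>l > 0\<close> by auto
    then show ?thesis using \<open>f x > 0\<close> \<open>g x > 0\<close> \<open>k > 0\<close> \<open>l > 0\<close> by (simp add: ln_mult)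
  qed
  then show ?thesis by blast
qed

lemma rpoly_int_min_poly_bigo:
  "(\<lambda>\<beta>. rpoly (int_min_poly \<beta>) \<xi>)
    \<in> O[principal {\<beta>. algebraic \<beta> \<and> alg_degree \<beta> \<le> n \<and> \<bar>\<xi> - \<beta>\<bar> \<le> 1}](
      \<lambda>\<beta>. of_int (alg_height \<beta>) * (\<xi> - \<beta>))"
proof -
  define C where "C = (real n + 1) * (\<bar>\<xi>\<bar> + 1) ^ n * real n"
  have "\<bar>rpoly (int_min_poly \<beta>) \<xi>\<bar> \<le> C * (of_int (alg_height \<beta>) * \<bar>\<xi> - \<beta>\<bar>)"
    if "algebraic \<beta>" "alg_degree \<beta> \<le> n" "\<bar>\<xi> - \<beta>\<bar> \<le> 1" for \<beta>
    using rpoly_lipschitz[of "int_min_poly \<beta>" n \<xi> "\<bar>\<xi>\<bar> + 1" \<beta>] that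
      is_int_min_polyD(1)[OF is_int_min_poly_int_min_poly[OF that(1)]]
    by (simp add: C_def alg_degree_def alg_height_def mult.assoc)
  then show ?thesis
    by (intro bigoI[of _ C])
      (auto simp: eventually_principal abs_mult alg_height_def poly_height_nonneg)
qed

section \<open>Upper and lower bounds for the exponents\<close>

lemma finite_small_values:
  fixes f h :: "'a \<Rightarrow> real"
  assumes finite: "\<And>B. finite {x \<in> S. h x \<le> B}" and h_ge_1: "\<And>x. x \<in> S \<Longrightarrow> h x \<ge> 1"
    and f: "f \<in> \<Omega>[principal S](\<lambda>x. h x powr - s)" and "s < t"
  shows "finite {x \<in> S. \<bar>f x\<bar> \<le> h x powr - t}"
proof -
  obtain c where "c > 0" and c: "\<And>x. x \<in> S \<Longrightarrow> c * h x powr - s \<le> \<bar>f x\<bar>"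
    using f by (elim landau_omega.bigE) (auto simp: eventually_principal)
  have "h x \<le> (1 / c) powr (1 / (t - s))" if x: "x \<in> S" "\<bar>f x\<bar> \<le> h x powr - t" for x
  proof -
    have "c * h x powr - s \<le> h x powr - t" using c[OF x(1)] x(2) by linarith
    then have "c * (h x powr - s * h x powr t) \<le> h x powr - t * h x powr t"
      by (metis mult.assoc mult_right_mono powr_ge_zero)
    then have "h x powr (t - s) \<le> 1 / c"
      using h_ge_1[OF x(1)] \<open>c > 0\<close> by (simp add: field_simps flip: powr_add)
    then have "(h x powr (t - s)) powr (1 / (t - s)) \<le> (1 / c) powr (1 / (t - s))"
      using \<open>s < t\<close> by (intro powr_mono2) auto
    then show ?thesis using h_ge_1[OF x(1)] \<open>s < t\<close> by (simp add: powr_powr)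
  qed
  then have "{x \<in> S. \<bar>f x\<bar> \<le> h x powr - t} \<subseteq> {x \<in> S. h x \<le> (1 / c) powr (1 / (t - s))}"
    by blast
  then show ?thesis using finite by (rule finite_subset)
qed

lemma infinite_small_values:
  fixes f h :: "'a \<Rightarrow> real" and x :: "nat \<Rightarrow> 'a"
  assumes mem: "eventually (\<lambda>j. x j \<in> S) sequentially"
    and h: "filterlim (\<lambda>j. h (x j)) at_top sequentially"
    and f: "(\<lambda>j. f (x j)) \<in> O(\<lambda>j. h (x j) powr - t)" and "s < t"
  shows "infinite {y \<in> S. \<bar>f y\<bar> \<le> h y powr - s}"
proof
  let ?A = "{y \<in> S. \<bar>f y\<bar> \<le> h y powr - s}"
  obtain c where "c > 0" and c: "eventually (\<lambda>j. \<bar>f (x j)\<bar> \<le> c * h (x j) powr - t) sequentially"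
    using f by (elim landau_o.bigE) auto
  have "eventually (\<lambda>j. h (x j) \<ge> c powr (1 / (t - s))) sequentially"
    using h by (simp add: filterlim_at_top)
  with mem c have in_A: "eventually (\<lambda>j. x j \<in> ?A) sequentially"
  proof eventually_elim
    case (elim j)
    have "h (x j) > 0" using elim(3) \<open>c > 0\<close> by (smt (verit) powr_gt_zero)
    have "c = (c powr (1 / (t - s))) powr (t - s)" using \<open>c > 0\<close> \<open>s < t\<close> by (simp add: powr_powr)
    also have "\<dots> \<le> h (x j) powr (t - s)" using elim(3) \<open>s < t\<close> by (intro powr_mono2) auto
    finally have "c * h (x j) powr - t \<le> h (x j) powr (t - s) * h (x j) powr - t"
      by (intro mult_right_mono) auto
    also have "\<dots> = h (x j) powr - s" using \<open>h (x j) > 0\<close> by (simp flip: powr_add)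
    finally show ?case using elim(1,2) by simp
  qed
  assume "finite ?A"
  then have "bdd_above (h ` ?A)" by (intro bdd_above_finite finite_imageI)
  then obtain B where "\<forall>y\<in>h ` ?A. y \<le> B" unfolding bdd_above_def by blast
  then have "eventually (\<lambda>j. h (x j) \<le> B) sequentially"
    using in_A by (auto elim: eventually_mono)
  moreover have "eventually (\<lambda>j. B < h (x j)) sequentially"
    using h by (simp add: filterlim_at_top_dense)
  ultimately have "eventually (\<lambda>j. False) sequentially"
    by eventually_elim simp
  then show False by simp
qed

lemma finite_real_height_if_finite_height:
  fixes h :: "'a \<Rightarrow> int"
  assumes "\<And>B. finite {x. x \<in> S \<and> h x \<le> B}"
  shows "finite {x \<in> S. real_of_int (h x) \<le> B}"
  using assms[of "\<lfloor>B\<rfloor>"] by (simp add: le_floor_iff)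

lemma Sup_ereal_le:
  assumes "\<And>v. u < v \<Longrightarrow> \<not> A v"
  shows "Sup {ereal v | v. A v} \<le> ereal u"
  by (rule Sup_least) (use assms in \<open>force simp: not_less[symmetric]\<close>)

lemma le_Sup_ereal:
  assumes "\<And>v. v < u \<Longrightarrow> A v"
  shows "ereal u \<le> Sup {ereal v | v. A v}"
proof (rule dense_le)
  fix y assume "y < ereal u"
  then obtain v where v: "y < ereal v" "v < u" by (metis ereal_dense2 less_ereal.simps(1))
  then have "ereal v \<in> {ereal v | v. A v}" using assms by blast
  then show "y \<le> Sup {ereal v | v. A v}" using v(1) by (meson Sup_upper less_imp_le order_trans)
qed

lemma w_exp_le:
  assumes "\<And>\<eta>. \<eta> > 0 \<Longrightarrow> (\<lambda>P. rpoly P \<xi>)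
    \<in> \<Omega>[principal {P. degree P \<le> n \<and> rpoly P \<xi> \<noteq> 0}](\<lambda>P. of_int (poly_height P) powr - (w + \<eta>))"
  shows "w_exp n \<xi> \<le> ereal w"
  unfolding w_exp_def
proof (rule Sup_ereal_le)
  fix v assume "w < v"
  let ?S = "{P. degree P \<le> n \<and> rpoly P \<xi> \<noteq> 0}"
  have "finite {P \<in> ?S. \<bar>rpoly P \<xi>\<bar> \<le> of_int (poly_height P) powr - v}"
  proof (rule finite_small_values)
    show "(\<lambda>P. rpoly P \<xi>) \<in> \<Omega>[principal ?S](\<lambda>P. of_int (poly_height P) powr - (w + (v - w) / 2))"
      using \<open>w < v\<close> by (intro assms) auto
    show "finite {P \<in> ?S. real_of_int (poly_height P) \<le> B}" for B
      by (rule finite_real_height_if_finite_height,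
          rule finite_subset[OF _ finite_int_poly_bounded_height[of n]]) auto
    show "1 \<le> real_of_int (poly_height P)" if "P \<in> ?S" for P
      using that by (intro iffD2[OF of_int_1_le_iff] poly_height_ge_1) auto
  qed (use \<open>w < v\<close> in \<open>simp add: field_simps\<close>)
  then show "\<not> infinite {P :: int poly. degree P \<le> n \<and> 0 < \<bar>rpoly P \<xi>\<bar> \<and>
      \<bar>rpoly P \<xi>\<bar> \<le> of_int (poly_height P) powr - v}"
    by (simp add: conj_assoc)
qed

lemma w_exp_ge:
  fixes P :: "nat \<Rightarrow> int poly"
  assumes "eventually (\<lambda>j. degree (P j) \<le> n \<and> rpoly (P j) \<xi> \<noteq> 0) sequentially"
    and "filterlim (\<lambda>j. real_of_int (poly_height (P j))) at_top sequentially"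
    and "\<And>v. v < w \<Longrightarrow> (\<lambda>j. rpoly (P j) \<xi>) \<in> O(\<lambda>j. of_int (poly_height (P j)) powr - v)"
  shows "ereal w \<le> w_exp n \<xi>"
  unfolding w_exp_def
proof (rule le_Sup_ereal)
  fix v assume "v < w"
  have "infinite {Q \<in> {Q. degree Q \<le> n \<and> rpoly Q \<xi> \<noteq> 0}.
      \<bar>rpoly Q \<xi>\<bar> \<le> of_int (poly_height Q) powr - v}"
    using assms(1,2) assms(3)[of "(v + w) / 2"] \<open>v < w\<close>
    by (intro infinite_small_values[where x = P and t = "(v + w) / 2"]) auto
  then show "infinite {Q :: int poly. degree Q \<le> n \<and> 0 < \<bar>rpoly Q \<xi>\<bar> \<and>
      \<bar>rpoly Q \<xi>\<bar> \<le> of_int (poly_height Q) powr - v}"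
    by (simp add: conj_assoc)
qed

lemma w_star_exp_le:
  assumes "\<And>\<eta>. \<eta> > 0 \<Longrightarrow> (\<lambda>\<alpha>. \<xi> - \<alpha>)
    \<in> \<Omega>[principal {\<alpha>. algebraic \<alpha> \<and> alg_degree \<alpha> \<le> n \<and> \<xi> \<noteq> \<alpha>}](
      \<lambda>\<alpha>. of_int (alg_height \<alpha>) powr - (w + 1 + \<eta>))"
  shows "w_star_exp n \<xi> \<le> ereal w"
  unfolding w_star_exp_def
proof (rule Sup_ereal_le)
  fix v assume "w < v"
  let ?S = "{\<alpha>. algebraic \<alpha> \<and> alg_degree \<alpha> \<le> n \<and> \<xi> \<noteq> \<alpha>}"
  have "finite {\<alpha> \<in> ?S. \<bar>\<xi> - \<alpha>\<bar> \<le> of_int (alg_height \<alpha>) powr - (v + 1)}"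
  proof (rule finite_small_values)
    show "(\<lambda>\<alpha>. \<xi> - \<alpha>) \<in> \<Omega>[principal ?S](\<lambda>\<alpha>. of_int (alg_height \<alpha>) powr - (w + 1 + (v - w) / 2))"
      using \<open>w < v\<close> by (intro assms) auto
    show "finite {\<alpha> \<in> ?S. real_of_int (alg_height \<alpha>) \<le> B}" for B
      by (rule finite_real_height_if_finite_height,
          rule finite_subset[OF _ finite_algebraic_bounded_height[of n]]) auto
    show "1 \<le> real_of_int (alg_height \<alpha>)" if "\<alpha> \<in> ?S" for \<alpha>
      using that alg_height_ge_1[of \<alpha>] by auto
  qed (use \<open>w < v\<close> in \<open>simp add: field_simps\<close>)
  moreover have "- v - 1 = - (v + 1)" by simp
  ultimately show "\<not> infinite {\<alpha> :: real. algebraic \<alpha> \<and> alg_degree \<alpha> \<le> n \<and> 0 < \<bar>\<xi> - \<alpha>\<bar> \<and>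
      \<bar>\<xi> - \<alpha>\<bar> \<le> of_int (alg_height \<alpha>) powr (- v - 1)}"
    by (simp only: mem_Collect_eq conj_assoc zero_less_abs_iff right_minus_eq not_not
      not_False_eq_True)
qed

lemma w_star_exp_ge:
  fixes \<alpha> :: "nat \<Rightarrow> real"
  assumes "eventually (\<lambda>j. algebraic (\<alpha> j) \<and> alg_degree (\<alpha> j) \<le> n \<and> \<xi> \<noteq> \<alpha> j) sequentially"
    and "filterlim (\<lambda>j. real_of_int (alg_height (\<alpha> j))) at_top sequentially"
    and "\<And>v. v < w \<Longrightarrow> (\<lambda>j. \<xi> - \<alpha> j) \<in> O(\<lambda>j. of_int (alg_height (\<alpha> j)) powr - (v + 1))"
  shows "ereal w \<le> w_star_exp n \<xi>"
  unfolding w_star_exp_def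
proof (rule le_Sup_ereal)
  fix v assume "v < w"
  have "infinite {\<beta> \<in> {\<beta>. algebraic \<beta> \<and> alg_degree \<beta> \<le> n \<and> \<xi> \<noteq> \<beta>}.
      \<bar>\<xi> - \<beta>\<bar> \<le> of_int (alg_height \<beta>) powr - (v + 1)}"
    using assms(1,2) assms(3)[of "(v + w) / 2"] \<open>v < w\<close>
    by (intro infinite_small_values[where x = \<alpha> and t = "(v + w) / 2 + 1"]) auto
  moreover have "- v - 1 = - (v + 1)" by simp
  ultimately show "infinite {\<beta> :: real. algebraic \<beta> \<and> alg_degree \<beta> \<le> n \<and> 0 < \<bar>\<xi> - \<beta>\<bar> \<and>
      \<bar>\<xi> - \<beta>\<bar> \<le> of_int (alg_height \<beta>) powr (- v - 1)}"
    by (simp only: mem_Collect_eq conj_assoc zero_less_abs_iff right_minus_eq not_not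
      not_False_eq_True)
qed

section \<open>Gaps in a rapidly growing sequence\<close>

lemma le_powr_if_le_mult_powr:
  fixes x y :: real
  assumes "c > 0" "c * x powr \<delta> \<le> y" "y \<le> K * x powr s" "x \<ge> 0" "y \<ge> 1" "0 \<le> s" "s < \<delta>" "K \<ge> 0"
  shows "y \<le> (K * (1 / c) powr (s / \<delta>)) powr (\<delta> / (\<delta> - s))"
proof -
  define K' where "K' = K * (1 / c) powr (s / \<delta>)"
  have "\<delta> > 0" using assms(6,7) by linarith
  have "y \<le> K * (x powr \<delta>) powr (s / \<delta>)" using assms(3) \<open>\<delta> > 0\<close> by (simp add: powr_powr)
  also have "\<dots> \<le> K * (1 / c * y) powr (s / \<delta>)"
    using assms \<open>\<delta> > 0\<close> by (intro mult_left_mono powr_mono2) (auto simp: field_simps)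
  also have "\<dots> = K' * y powr (s / \<delta>)"
    using assms(1,5) by (simp add: K'_def powr_mult powr_divide)
  finally have "y * y powr - (s / \<delta>) \<le> K' * y powr (s / \<delta>) * y powr - (s / \<delta>)"
    by (intro mult_right_mono) auto
  moreover have "y * y powr - (s / \<delta>) = y powr ((\<delta> - s) / \<delta>)"
    using assms(5) \<open>\<delta> > 0\<close> powr_add[of y 1 "- (s / \<delta>)"] by (simp add: diff_divide_distrib)
  ultimately have "y powr ((\<delta> - s) / \<delta>) \<le> K'"
    using assms(5) by (simp add: mult.assoc flip: powr_add)
  then have "(y powr ((\<delta> - s) / \<delta>)) powr (\<delta> / (\<delta> - s)) \<le> K' powr (\<delta> / (\<delta> - s))"
    using assms(7) \<open>\<delta> > 0\<close> by (intro powr_mono2) auto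
  then show ?thesis using assms(5,7) \<open>\<delta> > 0\<close> by (simp add: K'_def powr_powr)
qed

lemma gap_exists:
  fixes T :: "nat \<Rightarrow> real"
  assumes T_at_top: "filterlim T at_top sequentially"
    and "c > 0" and growth: "\<And>j. c * T j powr \<delta> \<le> T (Suc j)" and "s < \<delta>" and "M > 0"
  shows "\<exists>j. M * T j powr s \<le> T (Suc j)"
proof -
  obtain j where j: "(M / c) powr (1 / (\<delta> - s)) \<le> T j"
    using T_at_top by (fastforce simp: filterlim_at_top dest: eventually_happens)
  have "M / c = ((M / c) powr (1 / (\<delta> - s))) powr (\<delta> - s)"
    using \<open>M > 0\<close> \<open>c > 0\<close> \<open>s < \<delta>\<close> by (simp add: powr_powr)
  also have "\<dots> \<le> T j powr (\<delta> - s)" using j \<open>s < \<delta>\<close> by (intro powr_mono2) auto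
  finally have "M * T j powr s \<le> c * T j powr (\<delta> - s) * T j powr s"
    using \<open>c > 0\<close> by (intro mult_right_mono) (auto simp: field_simps)
  also have "\<dots> = c * T j powr \<delta>" by (simp flip: powr_add add: mult.assoc)
  also have "\<dots> \<le> T (Suc j)" by (rule growth)
  finally show ?thesis by blast
qed

lemma early_gap_exists:
  fixes T :: "nat \<Rightarrow> real"
  assumes T_ge_1: "\<And>j. T j \<ge> 1" and T_at_top: "filterlim T at_top sequentially"
    and "c > 0" and growth: "\<And>j. c * T j powr \<delta> \<le> T (Suc j)" and "0 \<le> s" "s < \<delta>" and "M > 0"
  shows "\<exists>C>0. \<forall>X\<ge>1. \<exists>j. M * X * T j powr s \<le> T (Suc j) \<and> T j \<le> C * X powr (\<delta> / (\<delta> - s))"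
proof -
  define e where "e = \<delta> / (\<delta> - s)"
  define K where "K = M * (1 / c) powr (s / \<delta>)"
  let ?C = "max (T 0) (K powr e)"
  have "e > 0" using \<open>0 \<le> s\<close> \<open>s < \<delta>\<close> by (simp add: e_def)
  have "?C > 0" using T_ge_1[of 0] by linarith
  have "\<exists>j. M * X * T j powr s \<le> T (Suc j) \<and> T j \<le> ?C * X powr e" if "X \<ge> 1" for X
  proof -
    let ?gap = "\<lambda>j. M * X * T j powr s \<le> T (Suc j)"
    define j where "j = (LEAST j. ?gap j)"
    have "\<exists>j. ?gap j"
      using gap_exists[OF T_at_top \<open>c > 0\<close> growth \<open>s < \<delta>\<close>, of "M * X"] \<open>M > 0\<close> \<open>X \<ge> 1\<close> by simp
    then have "?gap j" unfolding j_def by (rule LeastI_ex)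
    moreover have "T j \<le> ?C * X powr e"
    proof (cases j)
      case 0
      have "T 0 * 1 \<le> ?C * X powr e"
        using \<open>X \<ge> 1\<close> \<open>e > 0\<close> T_ge_1[of 0] by (intro mult_mono) (auto intro: ge_one_powr_ge_zero)
      then show ?thesis by (simp add: 0)
    next
      case (Suc i)
      then have "\<not> ?gap i" unfolding j_def by (intro not_less_Least) simp
      then have "T j \<le> M * X * T i powr s" by (simp add: Suc)
      then have "T j \<le> (M * X * (1 / c) powr (s / \<delta>)) powr e"
        unfolding e_def
          using \<open>c > 0\<close> \<open>M > 0\<close> \<open>X \<ge> 1\<close> \<open>0 \<le> s\<close> \<open>s < \<delta>\<close> growth[of i] T_ge_1[of i] T_ge_1[of j]
        by (intro le_powr_if_le_mult_powr[where x = "T i"]) (auto simp: Suc)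
      also have "\<dots> = K powr e * X powr e"
        using \<open>M > 0\<close> \<open>X \<ge> 1\<close> by (simp add: K_def powr_mult mult_ac)
      also have "\<dots> \<le> ?C * X powr e" by (intro mult_right_mono) auto
      finally show ?thesis .
    qed
    ultimately show ?thesis by blast
  qed
  with \<open>?C > 0\<close> show ?thesis unfolding e_def[symmetric] by (intro exI[of _ ?C]) simp
qed

lemma mult_power_le_powr:
  fixes x t C :: real
  assumes "t \<le> C * (x\<^sup>2) powr e" "2 * e * real n \<le> s" "x \<ge> 1" "t \<ge> 0" "C > 0"
  shows "x * t ^ n \<le> C ^ n * x powr (1 + s)"
proof -
  have "(x\<^sup>2) powr e = x powr (2 * e)" using assms(3) by (simp add: powr_powr flip: powr_numeral)
  then have "t ^ n \<le> (C * x powr (2 * e)) ^ n" using assms(1,4) by (intro power_mono) auto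
  also have "\<dots> = C ^ n * x powr (2 * e * real n)"
    using assms(3) by (simp add: power_mult_distrib powr_power mult_ac)
  also have "\<dots> \<le> C ^ n * x powr s" using assms(2,3,5) by (intro mult_left_mono powr_mono) auto
  finally have "x * t ^ n \<le> x * (C ^ n * x powr s)" using assms(3) by (intro mult_left_mono) auto
  then show ?thesis using assms(3) by (simp add: powr_add mult_ac)
qed

definition admissible_degree :: "real \<Rightarrow> nat \<Rightarrow> bool" where
  "admissible_degree w n \<longleftrightarrow> real n < w \<and> 2 * real n * w \<le> (w - 2) * (w - real n)"

lemma admissible_degreeI:
  assumes w: "w \<ge> (3 * real d + 2 + sqrt (9 * (real d)\<^sup>2 + 4 * real d + 4)) / 2" and "n \<le> d"
  shows "admissible_degree w n"
  unfolding admissible_degree_def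
proof
  define s where "s = sqrt (9 * (real d)\<^sup>2 + 4 * real d + 4)"
  have s: "s \<ge> 0" "s\<^sup>2 = 9 * (real d)\<^sup>2 + 4 * real d + 4" by (auto simp: s_def)
  have s_le: "s \<le> 2 * w - (3 * real d + 2)" using w by (simp add: s_def)
  then show "real n < w" using s(1) \<open>n \<le> d\<close> by linarith
  have "s\<^sup>2 \<le> (2 * w - (3 * real d + 2))\<^sup>2" using s_le s(1) by (intro power_mono)
  then have "2 * real d * w \<le> (w - 2) * (w - real d)"
    unfolding s(2) by (simp add: power2_eq_square algebra_simps)
  moreover have "0 \<le> (real d - real n) * (3 * w - 2)"
    using \<open>n \<le> d\<close> s_le s(1) by (intro mult_nonneg_nonneg) auto
  ultimately show "2 * real n * w \<le> (w - 2) * (w - real n)" by (simp add: algebra_simps)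
qed

lemma admissible_degree_imp_ge_2:
  assumes "admissible_degree w n"
  shows "w \<ge> 2"
proof (rule ccontr)
  assume "\<not> w \<ge> 2"
  then have "(w - 2) * (w - real n) < 0"
    using assms by (intro mult_neg_pos) (auto simp: admissible_degree_def)
  moreover have "2 * real n * w \<ge> 0" using assms by (simp add: admissible_degree_def)
  ultimately show False using assms unfolding admissible_degree_def by linarith
qed

lemma admissible_degree_gap_exponent:
  assumes "admissible_degree w n" "\<eta> > 0"
  obtains \<delta> where "real n < \<delta>" "\<delta> < w" "2 * real n * \<delta> / (\<delta> - real n) \<le> w - 2 + \<eta>"
proof -
  have "real n < w" "2 * real n * w \<le> (w - 2) * (w - real n)"
    using assms(1) by (simp_all add: admissible_degree_def)
  moreover have "0 < \<eta> * (w - real n)" using \<open>real n < w\<close> assms(2) by simp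
  ultimately have "2 * real n * w < (w - 2 + \<eta>) * (w - real n)" by (simp only: distrib_right)
  then have "2 * real n * w / (w - real n) < w - 2 + \<eta>"
    using \<open>real n < w\<close> by (simp add: pos_divide_less_eq)
  moreover have "((\<lambda>\<delta>. 2 * real n * \<delta> / (\<delta> - real n)) \<longlongrightarrow> 2 * real n * w / (w - real n)) (at_left w)"
    using \<open>real n < w\<close> by (intro tendsto_intros) auto
  ultimately have "eventually (\<lambda>\<delta>. 2 * real n * \<delta> / (\<delta> - real n) < w - 2 + \<eta>) (at_left w)"
    by (rule order_tendstoD(2)[rotated])
  moreover have "eventually (\<lambda>\<delta>. \<delta> \<in> {real n<..<w}) (at_left w)"
    by (rule eventually_at_left_real) fact
  ultimately have "eventually
      (\<lambda>\<delta>. real n < \<delta> \<and> \<delta> < w \<and> 2 * real n * \<delta> / (\<delta> - real n) \<le> w - 2 + \<eta>) (at_left w)"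
    by eventually_elim simp
  then show ?thesis using that eventually_happens' trivial_limit_at_left_real by blast
qed

section \<open>Exponents from a sequence of quadratic approximations\<close>

locale quadratic_approximations =
  fixes \<xi> w :: real and \<alpha> :: "nat \<Rightarrow> real" and F :: "nat \<Rightarrow> int poly" and T :: "nat \<Rightarrow> real"
  assumes T_def: "T j = of_int (poly_height (F j))"
    and min_poly: "is_int_min_poly (\<alpha> j) (F j)" and degree_F: "degree (F j) = 2"
    and T_at_top: "filterlim T at_top sequentially"
    and growth: "(\<lambda>j. ln (T (Suc j)) / ln (T j)) \<longlonglongrightarrow> w"
    and dist_alpha: "(\<lambda>j. \<xi> - \<alpha> j) \<in> \<Theta>[principal UNIV](\<lambda>j. 1 / T (Suc j))"
    and rpoly_F: "(\<lambda>j. rpoly (F j) \<xi>) \<in> \<Theta>[principal UNIV](\<lambda>j. 1 / T (Suc j))"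
begin

lemma F_nonzero: "F j \<noteq> 0"
  using degree_F[of j] by auto

lemma T_ge_1: "T j \<ge> 1"
  using poly_height_ge_1[OF F_nonzero] by (simp add: T_def)

lemma T_pos: "T j > 0"
  using T_ge_1[of j] by linarith

lemma eventually_ln_T_pos: "eventually (\<lambda>j. ln (T j) > 0) sequentially"
  using filterlim_compose[OF ln_at_top T_at_top] by (simp add: filterlim_at_top_dense)

lemma T_Suc_bigo:
  assumes "w < v"
  shows "(\<lambda>j. T (Suc j)) \<in> O[principal UNIV](\<lambda>j. T j powr v)"
proof (rule bigo_principal_UNIV_if_ln_le)
  show "eventually (\<lambda>j. ln (T (Suc j)) \<le> ln (T j powr v)) sequentially"
    using order_tendstoD(2)[OF growth assms] eventually_ln_T_pos
    by eventually_elim (use T_pos in \<open>simp add: field_simps ln_powr\<close>)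
qed (use T_pos in \<open>simp_all add: less_imp_neq[symmetric]\<close>)

lemma powr_T_bigo_T_Suc:
  assumes "v < w"
  shows "(\<lambda>j. T j powr v) \<in> O[principal UNIV](\<lambda>j. T (Suc j))"
proof (rule bigo_principal_UNIV_if_ln_le)
  show "eventually (\<lambda>j. ln (T j powr v) \<le> ln (T (Suc j))) sequentially"
    using order_tendstoD(1)[OF growth assms] eventually_ln_T_pos
    by eventually_elim (use T_pos in \<open>simp add: field_simps ln_powr\<close>)
qed (use T_pos in \<open>simp_all add: less_imp_neq[symmetric]\<close>)

lemma inverse_T_Suc_bigomega:
  assumes "w < v"
  shows "(\<lambda>j. 1 / T (Suc j)) \<in> \<Omega>[principal UNIV](\<lambda>j. T j powr - v)"
  using landau_o.big.inverse[OF _ _ T_Suc_bigo[OF assms]] T_pos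
  by (auto simp: bigomega_iff_bigo powr_minus divide_inverse less_imp_neq[symmetric])

lemma inverse_T_Suc_bigo:
  assumes "v < w"
  shows "(\<lambda>j. 1 / T (Suc j)) \<in> O(\<lambda>j. T j powr - v)"
  using landau_o.big.inverse[OF _ _ powr_T_bigo_T_Suc[OF assms]] T_pos
  by (auto simp: powr_minus divide_inverse less_imp_neq[symmetric]
    intro: landau_o.big.filter_mono[OF top_greatest])

lemma dist_alpha_le: "\<exists>D>0. \<forall>j. \<bar>\<xi> - \<alpha> j\<bar> \<le> D / T (Suc j)"
  using bigthetaD1[OF dist_alpha] T_pos by (elim landau_o.bigE) (auto simp: less_imp_le)

lemma alpha_bounded: "\<exists>R\<ge>1. \<forall>j. \<bar>\<xi>\<bar> \<le> R \<and> \<bar>\<alpha> j\<bar> \<le> R"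
proof -
  obtain D where "D > 0" and D: "\<And>j. \<bar>\<xi> - \<alpha> j\<bar> \<le> D / T (Suc j)" using dist_alpha_le by blast
  have "\<bar>\<alpha> j\<bar> \<le> \<bar>\<xi>\<bar> + D + 1" for j
  proof -
    have "D / T (Suc j) \<le> D / 1" using T_ge_1[of "Suc j"] \<open>D > 0\<close> by (intro divide_left_mono) auto
    then show ?thesis using D[of j] by linarith
  qed
  then show ?thesis using \<open>D > 0\<close> by (intro exI[of _ "\<bar>\<xi>\<bar> + D + 1"]) auto
qed

lemma liouville_alpha:
  "\<exists>c>0. \<forall>P j. degree P \<le> n \<longrightarrow> rpoly P (\<alpha> j) \<noteq> 0 \<longrightarrow>
    c \<le> of_int (poly_height P) * T j ^ n * \<bar>rpoly P (\<alpha> j)\<bar>"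
proof -
  obtain R where "R \<ge> 1" and R: "\<And>j. \<bar>\<alpha> j\<bar> \<le> R" using alpha_bounded by blast
  define C where "C = (real n + 1) * (1 + R) ^ n"
  have "C > 0" using \<open>R \<ge> 1\<close> by (simp add: C_def add_pos_nonneg)
  have "1 / C \<le> of_int (poly_height P) * T j ^ n * \<bar>rpoly P (\<alpha> j)\<bar>"
    if P: "degree P \<le> n" "rpoly P (\<alpha> j) \<noteq> 0" for P j
  proof -
    have "1 \<le> (real n + 1) * (1 + \<bar>\<alpha> j\<bar>) ^ n * T j ^ n * of_int (poly_height P) * \<bar>rpoly P (\<alpha> j)\<bar>"
      using quadratic_liouville[OF min_poly degree_F P] by (simp add: T_def)
    also have "\<dots> \<le> C * T j ^ n * of_int (poly_height P) * \<bar>rpoly P (\<alpha> j)\<bar>"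
      unfolding C_def using R[of j] T_pos[of j]
      by (intro mult_right_mono mult_left_mono power_mono) (auto simp: poly_height_nonneg)
    finally show ?thesis using \<open>C > 0\<close> by (simp add: field_simps)
  qed
  then show ?thesis using \<open>C > 0\<close> by (intro exI[of _ "1 / C"]) auto
qed

lemma rpoly_alpha_diff_le:
  "\<exists>L>0. \<forall>P j. degree P \<le> n \<longrightarrow>
    \<bar>rpoly P (\<alpha> j) - rpoly P \<xi>\<bar> \<le> L * of_int (poly_height P) / T (Suc j)"
proof -
  obtain R where "R \<ge> 1" and R: "\<And>j. \<bar>\<alpha> j\<bar> \<le> R" "\<bar>\<xi>\<bar> \<le> R" using alpha_bounded by blast
  obtain D where "D > 0" and D: "\<And>j. \<bar>\<xi> - \<alpha> j\<bar> \<le> D / T (Suc j)" using dist_alpha_le by blast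
  define L where "L = (real n + 1) * R ^ n * real n + 1"
  have "L > 0" using \<open>R \<ge> 1\<close> by (simp add: L_def add_nonneg_pos)
  have "\<bar>rpoly P (\<alpha> j) - rpoly P \<xi>\<bar> \<le> L * D * of_int (poly_height P) / T (Suc j)"
    if "degree P \<le> n" for P j
  proof -
    have "\<bar>rpoly P (\<alpha> j) - rpoly P \<xi>\<bar> \<le> (L - 1) * of_int (poly_height P) * \<bar>\<alpha> j - \<xi>\<bar>"
      using rpoly_lipschitz[OF that R \<open>R \<ge> 1\<close>] by (simp add: L_def)
    also have "\<dots> \<le> L * of_int (poly_height P) * (D / T (Suc j))"
      using D[of j] T_pos[of "Suc j"] poly_height_nonneg[of P] \<open>L > 0\<close>
      by (intro mult_mono) (auto simp: abs_minus_commute)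
    finally show ?thesis by (simp add: mult_ac)
  qed
  then show ?thesis using \<open>L > 0\<close> \<open>D > 0\<close> by (intro exI[of _ "L * D"]) auto
qed

lemma rpoly_lower_bound_across_gap:
  "\<exists>M>0. \<exists>c>0. \<forall>P j. degree P \<le> n \<longrightarrow> rpoly P (\<alpha> j) \<noteq> 0 \<longrightarrow>
    M * (of_int (poly_height P))\<^sup>2 * T j ^ n \<le> T (Suc j) \<longrightarrow>
    c \<le> of_int (poly_height P) * T j ^ n * \<bar>rpoly P \<xi>\<bar>"
proof -
  obtain L where "L > 0" and L: "\<And>P j. degree P \<le> n \<Longrightarrow>
      \<bar>rpoly P (\<alpha> j) - rpoly P \<xi>\<bar> \<le> L * of_int (poly_height P) / T (Suc j)"
    using rpoly_alpha_diff_le[of n] by blast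
  obtain c where "c > 0" and c: "\<And>P j. degree P \<le> n \<Longrightarrow> rpoly P (\<alpha> j) \<noteq> 0 \<Longrightarrow>
      c \<le> of_int (poly_height P) * T j ^ n * \<bar>rpoly P (\<alpha> j)\<bar>"
    using liouville_alpha[of n] by metis
  define M where "M = 2 * L / c"
  have "M > 0" using \<open>L > 0\<close> \<open>c > 0\<close> by (simp add: M_def)
  have "c / 2 \<le> of_int (poly_height P) * T j ^ n * \<bar>rpoly P \<xi>\<bar>"
    if P: "degree P \<le> n" "rpoly P (\<alpha> j) \<noteq> 0"
      and gap: "M * (of_int (poly_height P))\<^sup>2 * T j ^ n \<le> T (Suc j)" for P j
  proof -
    let ?H = "real_of_int (poly_height P)"
    have factor_nonneg: "?H * T j ^ n \<ge> 0" using T_pos[of j] by (simp add: poly_height_nonneg)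
    have "?H * T j ^ n * \<bar>rpoly P (\<alpha> j) - rpoly P \<xi>\<bar> \<le> ?H * T j ^ n * (L * ?H / T (Suc j))"
      using L[OF P(1)] factor_nonneg by (rule mult_left_mono)
    also have "\<dots> = c / 2 * (M * ?H\<^sup>2 * T j ^ n) / T (Suc j)"
      using \<open>c > 0\<close> by (simp add: M_def power2_eq_square)
    also have "\<dots> \<le> c / 2"
      using gap \<open>c > 0\<close> T_pos[of "Suc j"] by (simp add: pos_divide_le_eq)
    finally have "?H * T j ^ n * \<bar>rpoly P (\<alpha> j) - rpoly P \<xi>\<bar> \<le> c / 2" .
    moreover have "c \<le> ?H * T j ^ n * \<bar>rpoly P (\<alpha> j)\<bar>" by (rule c[OF P])
    moreover have "?H * T j ^ n * \<bar>rpoly P (\<alpha> j)\<bar>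
        \<le> ?H * T j ^ n * (\<bar>rpoly P (\<alpha> j) - rpoly P \<xi>\<bar> + \<bar>rpoly P \<xi>\<bar>)"
      using factor_nonneg by (intro mult_left_mono) auto
    ultimately show ?thesis by (simp add: distrib_left)
  qed
  then show ?thesis
    using \<open>M > 0\<close> \<open>c > 0\<close> by (intro exI[of _ M] conjI exI[of _ "c / 2"]) auto
qed

lemma powr_T_le_T_Suc:
  assumes "v < w"
  shows "\<exists>c>0. \<forall>j. c * T j powr v \<le> T (Suc j)"
proof -
  obtain c where "c > 0" and c: "\<And>j. T j powr v \<le> c * T (Suc j)"
    using powr_T_bigo_T_Suc[OF assms] T_pos by (elim landau_o.bigE) (auto simp: less_imp_le)
  then show ?thesis by (intro exI[of _ "1 / c"]) (auto simp: field_simps)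
qed

lemma early_T_gap_exists:
  assumes "real n < \<delta>" "\<delta> < w" "M > 0"
  shows "\<exists>C>0. \<forall>X\<ge>1. \<exists>j. M * X * T j ^ n \<le> T (Suc j) \<and> T j \<le> C * X powr (\<delta> / (\<delta> - real n))"
proof -
  obtain c where "c > 0" "\<And>j. c * T j powr \<delta> \<le> T (Suc j)"
    using powr_T_le_T_Suc[OF assms(2)] by blast
  then show ?thesis
    using early_gap_exists[OF T_ge_1 T_at_top, of c \<delta> "real n" M] assms(1,3) T_pos
    by (simp add: powr_realpow)
qed

definition no_alpha_root :: "int poly \<Rightarrow> bool" where
  "no_alpha_root P \<longleftrightarrow> (\<forall>j. rpoly P (\<alpha> j) \<noteq> 0)"

lemma rpoly_lower_bound_no_alpha_root:
  assumes "admissible_degree w n" "\<eta> > 0"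
  shows "(\<lambda>P. rpoly P \<xi>)
    \<in> \<Omega>[principal {P. degree P \<le> n \<and> no_alpha_root P}](
      \<lambda>P. of_int (poly_height P) powr - (w - 1 + \<eta>))"
proof -
  obtain \<delta> where \<delta>: "real n < \<delta>" "\<delta> < w" "2 * real n * \<delta> / (\<delta> - real n) \<le> w - 2 + \<eta>"
    by (rule admissible_degree_gap_exponent[OF assms])
  define e where "e = \<delta> / (\<delta> - real n)"
  obtain M c where "M > 0" "c > 0" and across_gap: "\<And>P j. degree P \<le> n \<Longrightarrow> rpoly P (\<alpha> j) \<noteq> 0 \<Longrightarrow>
      M * (of_int (poly_height P))\<^sup>2 * T j ^ n \<le> T (Suc j) \<Longrightarrow>
      c \<le> of_int (poly_height P) * T j ^ n * \<bar>rpoly P \<xi>\<bar>"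
    using rpoly_lower_bound_across_gap[of n] by blast
  obtain C where "C > 0" and C: "\<And>X. X \<ge> 1 \<Longrightarrow>
      \<exists>j. M * X * T j ^ n \<le> T (Suc j) \<and> T j \<le> C * X powr e"
    using early_T_gap_exists[OF \<delta>(1,2) \<open>M > 0\<close>] unfolding e_def by blast
  have "c / C ^ n * of_int (poly_height P) powr - (w - 1 + \<eta>) \<le> \<bar>rpoly P \<xi>\<bar>"
    if P: "degree P \<le> n" "no_alpha_root P" for P
  proof -
    define H where "H = real_of_int (poly_height P)"
    have "H \<ge> 1"
      using P(2) poly_height_ge_1[of P] by (cases "P = 0") (auto simp: H_def no_alpha_root_def)
    obtain j where j: "M * H\<^sup>2 * T j ^ n \<le> T (Suc j)" "T j \<le> C * (H\<^sup>2) powr e"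
      using C[of "H\<^sup>2"] \<open>H \<ge> 1\<close> by (auto simp: one_le_power)
    have "2 * e * real n \<le> w - 2 + \<eta>" using \<delta>(3) by (simp add: e_def mult_ac)
    then have "H * T j ^ n \<le> C ^ n * H powr (1 + (w - 2 + \<eta>))"
      using j(2) \<open>H \<ge> 1\<close> T_pos[of j] \<open>C > 0\<close> by (intro mult_power_le_powr[where e = e]) auto
    then have "H * T j ^ n \<le> C ^ n * H powr (w - 1 + \<eta>)" by (simp add: algebra_simps)
    then have "H * T j ^ n * \<bar>rpoly P \<xi>\<bar> \<le> C ^ n * H powr (w - 1 + \<eta>) * \<bar>rpoly P \<xi>\<bar>"
      by (rule mult_right_mono) simp
    moreover have "c \<le> H * T j ^ n * \<bar>rpoly P \<xi>\<bar>"
      unfolding H_def using P j(1) by (intro across_gap) (auto simp: no_alpha_root_def H_def)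
    ultimately have "c \<le> C ^ n * H powr (w - 1 + \<eta>) * \<bar>rpoly P \<xi>\<bar>" by linarith
    then show ?thesis
      unfolding H_def[symmetric] powr_minus using \<open>C > 0\<close> \<open>H \<ge> 1\<close> by (simp add: field_simps)
  qed
  then show ?thesis
    using \<open>c > 0\<close> \<open>C > 0\<close> by (intro bigomega_principalI[of "c / C ^ n"]) auto
qed

lemma rpoly_F_bigomega:
  assumes "w < v"
  shows "(\<lambda>j. rpoly (F j) \<xi>) \<in> \<Omega>[principal UNIV](\<lambda>j. T j powr - v)"
  using bigthetaD2[OF rpoly_F] inverse_T_Suc_bigomega[OF assms] by (rule landau_omega.big_trans)

lemma F_dvd_if_not_no_alpha_root:
  assumes "\<not> no_alpha_root P" "P \<noteq> 0"
  shows "\<exists>j R. P = F j * R \<and> R \<noteq> 0 \<and> degree P = degree R + 2"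
proof -
  obtain j where "rpoly P (\<alpha> j) = 0" using assms(1) by (auto simp: no_alpha_root_def)
  then obtain R where R: "P = F j * R"
    using is_int_min_poly_dvd_iff[OF min_poly] by (metis dvdE)
  with assms(2) have "R \<noteq> 0" by auto
  then have "degree P = degree R + 2" using F_nonzero by (simp add: R degree_mult_eq degree_F)
  then show ?thesis using R \<open>R \<noteq> 0\<close> by blast
qed

lemma rpoly_lower_bound_alpha_root:
  assumes "w < s" "s \<ge> 0"
    and quotient_bound: "(\<lambda>R. rpoly R \<xi>)
      \<in> \<Omega>[principal {R. R \<noteq> 0 \<and> degree R \<le> m}](\<lambda>R. of_int (poly_height R) powr - s)"
  shows "(\<lambda>P. rpoly P \<xi>)
    \<in> \<Omega>[principal {P. P \<noteq> 0 \<and> degree P \<le> Suc m \<and> \<not> no_alpha_root P}](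
      \<lambda>P. of_int (poly_height P) powr - s)"
proof -
  obtain c where "c > 0" and c: "\<And>j. c * T j powr - s \<le> \<bar>rpoly (F j) \<xi>\<bar>"
    using rpoly_F_bigomega[OF assms(1)] by (elim landau_omega.bigE) auto
  obtain c' where "c' > 0" and c': "\<And>R. R \<noteq> 0 \<Longrightarrow> degree R \<le> m \<Longrightarrow>
      c' * of_int (poly_height R) powr - s \<le> \<bar>rpoly R \<xi>\<bar>"
    using quotient_bound by (elim landau_omega.bigE) (auto simp: eventually_principal)
  define D where "D = 2 ^ Suc m * (real (Suc m) + 1)"
  define k where "k = c * c' * D powr - s"
  show ?thesis
  proof (rule bigomega_principalI)
    show "k > 0" using \<open>c > 0\<close> \<open>c' > 0\<close> by (simp add: k_def D_def)
    fix P assume P: "P \<in> {P. P \<noteq> 0 \<and> degree P \<le> Suc m \<and> \<not> no_alpha_root P}"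
    obtain j R where R: "P = F j * R" "R \<noteq> 0" "degree P = degree R + 2"
      using F_dvd_if_not_no_alpha_root[of P] P by blast
    have "D powr - s * of_int (poly_height P) powr - s
        \<le> T j powr - s * of_int (poly_height R) powr - s"
      unfolding D_def R(1) T_def using P R assms(2)
      by (intro powr_poly_height_mult_le) (auto simp: degree_F)
    then have "k * of_int (poly_height P) powr - s
        \<le> c * c' * (T j powr - s * of_int (poly_height R) powr - s)"
      unfolding k_def mult.assoc using \<open>c > 0\<close> \<open>c' > 0\<close> by (intro mult_left_mono) auto
    also have "\<dots> = (c * T j powr - s) * (c' * of_int (poly_height R) powr - s)" by simp
    also have "\<dots> \<le> \<bar>rpoly (F j) \<xi>\<bar> * \<bar>rpoly R \<xi>\<bar>"
    proof (rule mult_mono)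
      show "c' * of_int (poly_height R) powr - s \<le> \<bar>rpoly R \<xi>\<bar>" using P R by (intro c') auto
    qed (use c \<open>c' > 0\<close> in auto)
    also have "\<dots> = \<bar>rpoly P \<xi>\<bar>" by (simp add: R(1) of_int_poly_hom.hom_mult abs_mult)
    finally show "k * \<bar>of_int (poly_height P) powr - s\<bar> \<le> \<bar>rpoly P \<xi>\<bar>" by simp
  qed
qed

lemma rpoly_lower_bound:
  assumes "admissible_degree w n" "\<eta> > 0"
  shows "(\<lambda>P. rpoly P \<xi>)
    \<in> \<Omega>[principal {P. P \<noteq> 0 \<and> degree P \<le> n}](\<lambda>P. of_int (poly_height P) powr - (w + \<eta>))"
proof -
  have no_root: "(\<lambda>P. rpoly P \<xi>)
      \<in> \<Omega>[principal {P. degree P \<le> n \<and> no_alpha_root P}](\<lambda>P. of_int (poly_height P) powr - (w + \<eta>))"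
    using rpoly_lower_bound_no_alpha_root[OF assms(1), of "\<eta> + 1"] assms(2)
    by (simp add: algebra_simps)
  have "(\<lambda>P. rpoly P \<xi>)
      \<in> \<Omega>[principal {P. P \<noteq> 0 \<and> degree P \<le> m}](\<lambda>P. of_int (poly_height P) powr - (w + \<eta>))"
    if "m \<le> n" for m
    using that
  proof (induction m)
    case 0
    have "no_alpha_root P" if "P \<noteq> 0" "degree P = 0" for P
      using F_dvd_if_not_no_alpha_root[OF _ that(1)] that(2) by auto
    then show ?case
      by (intro landau_omega.big.filter_mono[OF _ no_root]) auto
  next
    case (Suc m)
    have "w + \<eta> \<ge> 0" using admissible_degree_imp_ge_2[OF assms(1)] assms(2) by simp
    then have root: "(\<lambda>P. rpoly P \<xi>)
        \<in> \<Omega>[principal {P. P \<noteq> 0 \<and> degree P \<le> Suc m \<and> \<not> no_alpha_root P}](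
          \<lambda>P. of_int (poly_height P) powr - (w + \<eta>))"
      using Suc assms(2) by (intro rpoly_lower_bound_alpha_root) auto
    show ?case by (rule bigomega_union[OF no_root root]) (use Suc.prems in auto)
  qed
  then show ?thesis by blast
qed

lemma int_min_poly_alpha: "algebraic (\<alpha> j)" "int_min_poly (\<alpha> j) = F j"
  using is_int_min_poly_eq_int_min_poly[OF min_poly] by auto

lemma alg_height_alpha: "of_int (alg_height (\<alpha> j)) = T j"
  by (simp add: alg_height_def int_min_poly_alpha T_def)

lemma dist_lower_bound_no_alpha_root:
  assumes "admissible_degree w n" "\<eta> > 0"
  shows "(\<lambda>\<beta>. \<xi> - \<beta>)
    \<in> \<Omega>[principal {\<beta>. algebraic \<beta> \<and> alg_degree \<beta> \<le> n \<and> no_alpha_root (int_min_poly \<beta>)}](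
      \<lambda>\<beta>. of_int (alg_height \<beta>) powr - (w + \<eta>))"
proof (rule bigomega_union)
  let ?S = "{\<beta>. algebraic \<beta> \<and> alg_degree \<beta> \<le> n \<and> no_alpha_root (int_min_poly \<beta>)}"
  let ?near = "{\<beta> \<in> ?S. \<bar>\<xi> - \<beta>\<bar> \<le> 1}" and ?far = "{\<beta> \<in> ?S. \<bar>\<xi> - \<beta>\<bar> > 1}"
  let ?H = "\<lambda>\<beta>. real_of_int (alg_height \<beta>)"
  have H: "?H \<beta> \<ge> 1" if "algebraic \<beta>" for \<beta> using alg_height_ge_1[OF that] by simp
  have "(\<lambda>\<beta>. ?H \<beta> * (\<xi> - \<beta>)) \<in> \<Omega>[principal ?near](\<lambda>\<beta>. rpoly (int_min_poly \<beta>) \<xi>)"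
    unfolding bigomega_iff_bigo
    by (rule landau_o.big.filter_mono[OF _ rpoly_int_min_poly_bigo[of \<xi> n]]) auto
  also have "(\<lambda>\<beta>. rpoly (int_min_poly \<beta>) \<xi>) \<in> \<Omega>[principal ?near](\<lambda>\<beta>. ?H \<beta> powr - (w - 1 + \<eta>))"
    unfolding alg_height_def
    by (rule landau_omega.big.compose[OF rpoly_lower_bound_no_alpha_root[OF assms]])
      (auto simp: filterlim_principal eventually_principal alg_degree_def)
  finally have "(\<lambda>\<beta>. inverse (?H \<beta>) * (?H \<beta> * (\<xi> - \<beta>)))
      \<in> \<Omega>[principal ?near](\<lambda>\<beta>. inverse (?H \<beta>) * ?H \<beta> powr - (w - 1 + \<eta>))"
    by (rule landau_omega.big.mult[OF landau_omega.big_refl])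
  moreover have "inverse (?H \<beta>) * (?H \<beta> * (\<xi> - \<beta>)) = \<xi> - \<beta>"
    "inverse (?H \<beta>) * ?H \<beta> powr - (w - 1 + \<eta>) = ?H \<beta> powr - (w + \<eta>)" if "\<beta> \<in> ?near" for \<beta>
    using H[of \<beta>] that powr_add[of "?H \<beta>" "- 1" "- (w - 1 + \<eta>)"] by (auto simp: powr_minus)
  ultimately show "(\<lambda>\<beta>. \<xi> - \<beta>) \<in> \<Omega>[principal ?near](\<lambda>\<beta>. ?H \<beta> powr - (w + \<eta>))"
    by (subst (asm) landau_omega.big.cong_ex) (auto simp: eventually_principal)
  show "(\<lambda>\<beta>. \<xi> - \<beta>) \<in> \<Omega>[principal ?far](\<lambda>\<beta>. ?H \<beta> powr - (w + \<eta>))"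
  proof (rule bigomega_principalI)
    fix \<beta> assume "\<beta> \<in> ?far"
    then have "?H \<beta> powr - (w + \<eta>) \<le> ?H \<beta> powr 0"
      using H admissible_degree_imp_ge_2[OF assms(1)] assms(2) by (intro powr_mono) auto
    also have "\<dots> \<le> \<bar>\<xi> - \<beta>\<bar>" using \<open>\<beta> \<in> ?far\<close> H[of \<beta>] by simp
    finally show "1 * \<bar>?H \<beta> powr - (w + \<eta>)\<bar> \<le> \<bar>\<xi> - \<beta>\<bar>" by simp
  qed simp
qed auto

lemma dist_conjugate_lower_bound:
  assumes \<beta>: "\<And>j x. rpoly (F j) x = of_int (lead_coeff (F j)) * (x - \<alpha> j) * (x - \<beta> j)"
    and "s \<ge> 1"
  shows "(\<lambda>j. \<xi> - \<beta> j) \<in> \<Omega>[principal UNIV](\<lambda>j. T j powr - s)"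
proof -
  obtain D where "D > 0" and D: "\<And>j. \<bar>\<xi> - \<alpha> j\<bar> \<le> D / T (Suc j)" using dist_alpha_le by blast
  obtain c where "c > 0" and c: "\<And>j. c * \<bar>1 / T (Suc j)\<bar> \<le> \<bar>rpoly (F j) \<xi>\<bar>"
    using bigthetaD2[OF rpoly_F] by (elim landau_omega.bigE) auto
  have "c / D * T j powr - s \<le> \<bar>\<xi> - \<beta> j\<bar>" for j
  proof -
    let ?a = "\<bar>real_of_int (lead_coeff (F j))\<bar>"
    have "c * (1 / T (Suc j)) \<le> ?a * \<bar>\<xi> - \<alpha> j\<bar> * \<bar>\<xi> - \<beta> j\<bar>"
      using c[of j] T_pos[of "Suc j"] by (simp add: \<beta> abs_mult)
    also have "\<dots> \<le> T j * (D * (1 / T (Suc j))) * \<bar>\<xi> - \<beta> j\<bar>"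
      using D[of j] T_pos[of "Suc j"] T_pos[of j]
        abs_of_int_coeff_le_poly_height[of "F j" "degree (F j)"]
      by (intro mult_right_mono mult_mono) (auto simp: T_def)
    finally have "c / D * (1 / T j) \<le> \<bar>\<xi> - \<beta> j\<bar>"
      using T_pos[of "Suc j"] T_pos[of j] \<open>D > 0\<close> by (simp add: field_simps)
    moreover have "T j powr - s \<le> 1 / T j"
      using powr_mono[of "- s" "- 1" "T j"] assms(2) T_ge_1[of j] by (simp add: powr_minus_divide)
    then have "c / D * T j powr - s \<le> c / D * (1 / T j)"
      using \<open>c > 0\<close> \<open>D > 0\<close> by (intro mult_left_mono) auto
    ultimately show ?thesis by linarith
  qed
  then show ?thesis
    using \<open>c > 0\<close> \<open>D > 0\<close> by (intro bigomega_principalI[of "c / D"]) auto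
qed

lemma root_eq_alpha_or_conjugate:
  assumes \<alpha>': "\<And>j x. rpoly (F j) x = of_int (lead_coeff (F j)) * (x - \<alpha> j) * (x - \<alpha>' j)"
    and "algebraic \<beta>" "\<not> no_alpha_root (int_min_poly \<beta>)"
  shows "\<beta> \<in> range \<alpha> \<union> range \<alpha>'"
proof -
  note min_poly_\<beta> = is_int_min_poly_int_min_poly[OF assms(2)]
  obtain j where "rpoly (int_min_poly \<beta>) (\<alpha> j) = 0"
    using assms(3) by (auto simp: no_alpha_root_def)
  with min_poly_\<beta> have "is_int_min_poly (\<alpha> j) (int_min_poly \<beta>)" by (rule is_int_min_poly_conjugate)
  then have "int_min_poly \<beta> = F j" using is_int_min_poly_unique[OF _ min_poly] by blast
  then have "rpoly (F j) \<beta> = 0" using is_int_min_polyD(1)[OF min_poly_\<beta>] by simp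
  then show ?thesis using is_int_min_polyD(3)[OF min_poly, of j] by (auto simp: \<alpha>')
qed

lemma dist_lower_bound:
  assumes "admissible_degree w n" "\<eta> > 0"
  shows "(\<lambda>\<beta>. \<xi> - \<beta>)
    \<in> \<Omega>[principal {\<beta>. algebraic \<beta> \<and> alg_degree \<beta> \<le> n \<and> \<xi> \<noteq> \<beta>}](
      \<lambda>\<beta>. of_int (alg_height \<beta>) powr - (w + \<eta>))"
proof -
  have "\<exists>\<beta>. \<forall>x. rpoly (F j) x = of_int (lead_coeff (F j)) * (x - \<alpha> j) * (x - \<beta>)" for j
    by (rule quadratic_poly_conjugate[OF degree_F is_int_min_polyD(1)[OF min_poly]]) blast
  then obtain \<alpha>' where \<alpha>':
    "\<And>j x. rpoly (F j) x = of_int (lead_coeff (F j)) * (x - \<alpha> j) * (x - \<alpha>' j)"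
    by metis
  have height_\<alpha>': "of_int (alg_height (\<alpha>' j)) = T j" for j
    using is_int_min_poly_eq_int_min_poly(2)[OF
        is_int_min_poly_conjugate[OF min_poly[of j], where \<beta> = "\<alpha>' j"]]
    by (simp add: \<alpha>' alg_height_def T_def)
  have "(\<lambda>j. \<xi> - \<alpha> j) \<in> \<Omega>[principal UNIV](\<lambda>j. of_int (alg_height (\<alpha> j)) powr - (w + \<eta>))"
    unfolding alg_height_alpha using assms(2)
    by (intro landau_omega.big_trans[OF bigthetaD2[OF dist_alpha] inverse_T_Suc_bigomega]) simp
  then have at_alpha: "(\<lambda>\<beta>. \<xi> - \<beta>)
      \<in> \<Omega>[principal (range \<alpha>)](\<lambda>\<beta>. of_int (alg_height \<beta>) powr - (w + \<eta>))"
    unfolding filtermap_principal[symmetric] landau_omega.big.in_filtermap_iff .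
  have "(\<lambda>j. \<xi> - \<alpha>' j) \<in> \<Omega>[principal UNIV](\<lambda>j. of_int (alg_height (\<alpha>' j)) powr - (w + \<eta>))"
    unfolding height_\<alpha>' using admissible_degree_imp_ge_2[OF assms(1)] assms(2)
    by (intro dist_conjugate_lower_bound[OF \<alpha>']) simp
  then have at_conjugate: "(\<lambda>\<beta>. \<xi> - \<beta>)
      \<in> \<Omega>[principal (range \<alpha>')](\<lambda>\<beta>. of_int (alg_height \<beta>) powr - (w + \<eta>))"
    unfolding filtermap_principal[symmetric] landau_omega.big.in_filtermap_iff .
  have at_root: "(\<lambda>\<beta>. \<xi> - \<beta>)
      \<in> \<Omega>[principal (range \<alpha> \<union> range \<alpha>')](\<lambda>\<beta>. of_int (alg_height \<beta>) powr - (w + \<eta>))"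
    by (rule bigomega_union[OF at_alpha at_conjugate order.refl])
  show ?thesis
  proof (rule bigomega_union[OF dist_lower_bound_no_alpha_root[OF assms] at_root], rule subsetI)
    fix \<beta> assume "\<beta> \<in> {\<beta>. algebraic \<beta> \<and> alg_degree \<beta> \<le> n \<and> \<xi> \<noteq> \<beta>}"
    then show "\<beta> \<in> {\<beta>. algebraic \<beta> \<and> alg_degree \<beta> \<le> n \<and> no_alpha_root (int_min_poly \<beta>)}
        \<union> (range \<alpha> \<union> range \<alpha>')"
      using root_eq_alpha_or_conjugate[OF \<alpha>', of \<beta>] by auto
  qed
qed

lemma bigtheta_inverse_T_SucD:
  assumes "f \<in> \<Theta>[principal UNIV](\<lambda>j. 1 / T (Suc j))"
  shows "f j \<noteq> 0" and "v < w \<Longrightarrow> f \<in> O(\<lambda>j. T j powr - v)"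
proof -
  obtain c where "c > 0" and c: "\<And>j. c * \<bar>1 / T (Suc j)\<bar> \<le> \<bar>f j\<bar>"
    using bigthetaD2[OF assms] by (elim landau_omega.bigE) auto
  have "0 < c * \<bar>1 / T (Suc j)\<bar>" using \<open>c > 0\<close> T_pos[of "Suc j"] by simp
  then show "f j \<noteq> 0" using c[of j] by auto
  have "sequentially \<le> principal UNIV" by simp
  then show "f \<in> O(\<lambda>j. T j powr - v)" if "v < w"
    using landau_o.big_trans[OF landau_o.big.filter_mono[OF _ bigthetaD1[OF assms]]
      inverse_T_Suc_bigo[OF that]]
    by blast
qed

lemma w_exp_eq:
  assumes "2 \<le> n" "admissible_degree w n"
  shows "w_exp n \<xi> = ereal w"
proof (rule antisym)
  show "w_exp n \<xi> \<le> ereal w"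
  proof (rule w_exp_le)
    fix \<eta> :: real assume "\<eta> > 0"
    have "principal {P. degree P \<le> n \<and> rpoly P \<xi> \<noteq> 0} \<le> principal {P. P \<noteq> 0 \<and> degree P \<le> n}" by auto
    then show "(\<lambda>P. rpoly P \<xi>)
        \<in> \<Omega>[principal {P. degree P \<le> n \<and> rpoly P \<xi> \<noteq> 0}](\<lambda>P. of_int (poly_height P) powr - (w + \<eta>))"
      using rpoly_lower_bound[OF assms(2) \<open>\<eta> > 0\<close>] by (rule landau_omega.big.filter_mono)
  qed
  show "ereal w \<le> w_exp n \<xi>"
  proof (rule w_exp_ge)
    show "eventually (\<lambda>j. degree (F j) \<le> n \<and> rpoly (F j) \<xi> \<noteq> 0) sequentially"
      using assms(1) bigtheta_inverse_T_SucD(1)[OF rpoly_F] by (simp add: degree_F)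
    show "filterlim (\<lambda>j. real_of_int (poly_height (F j))) at_top sequentially"
      unfolding T_def[symmetric] by (rule T_at_top)
    show "(\<lambda>j. rpoly (F j) \<xi>) \<in> O(\<lambda>j. of_int (poly_height (F j)) powr - v)" if "v < w" for v
      using bigtheta_inverse_T_SucD(2)[OF rpoly_F that] by (simp add: T_def)
  qed
qed

lemma w_star_exp_eq:
  assumes "2 \<le> n" "admissible_degree w n"
  shows "w_star_exp n \<xi> = ereal (w - 1)"
proof (rule antisym)
  show "w_star_exp n \<xi> \<le> ereal (w - 1)"
    using dist_lower_bound[OF assms(2)] by (intro w_star_exp_le) simp
  show "ereal (w - 1) \<le> w_star_exp n \<xi>"
  proof (rule w_star_exp_ge)
    show "eventually (\<lambda>j. algebraic (\<alpha> j) \<and> alg_degree (\<alpha> j) \<le> n \<and> \<xi> \<noteq> \<alpha> j) sequentially"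
      using assms(1) bigtheta_inverse_T_SucD(1)[OF dist_alpha]
      by (simp add: alg_degree_def int_min_poly_alpha degree_F)
    show "filterlim (\<lambda>j. real_of_int (alg_height (\<alpha> j))) at_top sequentially"
      unfolding alg_height_alpha by (rule T_at_top)
    show "(\<lambda>j. \<xi> - \<alpha> j) \<in> O(\<lambda>j. of_int (alg_height (\<alpha> j)) powr - (v + 1))" if "v < w - 1" for v
      unfolding alg_height_alpha using that
      by (intro bigtheta_inverse_T_SucD(2)[OF dist_alpha]) simp
  qed
qed

end

section \<open>Continued fractions\<close>

primrec cfrac_with_tail :: "(nat \<Rightarrow> int) \<Rightarrow> nat \<Rightarrow> real \<Rightarrow> real" where
  "cfrac_with_tail c 0 t = t"
| "cfrac_with_tail c (Suc n) t = cfrac_with_tail c n (of_int (c n) + 1 / t)"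

lemma finite_cfrac_eq_cfrac_with_tail:
  "n < m \<Longrightarrow> finite_cfrac (map c [0..<m]) = cfrac_with_tail c n (finite_cfrac (map c [n..<m]))"
proof (induction n)
  case (Suc n)
  have "map c [n..<m] = c n # c (Suc n) # map c [Suc (Suc n)..<m]"
    using Suc.prems by (simp add: upt_conv_Cons)
  moreover have "map c [Suc n..<m] = c (Suc n) # map c [Suc (Suc n)..<m]"
    using Suc.prems by (simp add: upt_conv_Cons)
  ultimately show ?case using Suc by simp
qed simp

lemma finite_cfrac_ge_1:
  "xs \<noteq> [] \<Longrightarrow> (\<And>x. x \<in> set xs \<Longrightarrow> x \<ge> 1) \<Longrightarrow> finite_cfrac xs \<ge> 1"
proof (induction xs rule: finite_cfrac.induct)
  case (3 x y ys)
  then have "1 / finite_cfrac (y # ys) \<ge> 0" "real_of_int x \<ge> 1" by auto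
  then show ?case unfolding finite_cfrac.simps by linarith
qed auto

lemma cfrac_with_tail_in_Rats_iff: "cfrac_with_tail c n t \<in> \<rat> \<longleftrightarrow> t \<in> \<rat>"
proof (induction n arbitrary: t)
  case (Suc n)
  have "of_int (c n) + 1 / t \<in> \<rat> \<longleftrightarrow> t \<in> \<rat>"
  proof
    assume "of_int (c n) + 1 / t \<in> \<rat>"
    then have "1 / (of_int (c n) + 1 / t - of_int (c n)) \<in> \<rat>"
      by (intro Rats_divide Rats_diff Rats_of_int Rats_1)
    then show "t \<in> \<rat>" by simp
  qed simp
  then show ?case using Suc by simp
qed simp

text \<open>Shifted by one from the usual numbering: \<open>conv_num c n / conv_den c n\<close> is the convergent
  with the digits \<open>c 0, \<dots>, c (n - 1)\<close>.\<close>

fun conv_num :: "(nat \<Rightarrow> int) \<Rightarrow> nat \<Rightarrow> int" where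
  "conv_num c 0 = 1"
| "conv_num c (Suc 0) = c 0"
| "conv_num c (Suc (Suc n)) = c (Suc n) * conv_num c (Suc n) + conv_num c n"

fun conv_den :: "(nat \<Rightarrow> int) \<Rightarrow> nat \<Rightarrow> int" where
  "conv_den c 0 = 0"
| "conv_den c (Suc 0) = 1"
| "conv_den c (Suc (Suc n)) = c (Suc n) * conv_den c (Suc n) + conv_den c n"

lemma conv_num_conv_den_det:
  "conv_num c (Suc n) * conv_den c n - conv_num c n * conv_den c (Suc n) = (-1) ^ Suc n"
  by (induction n) (auto simp: algebra_simps)

definition num_at :: "(nat \<Rightarrow> int) \<Rightarrow> nat \<Rightarrow> real \<Rightarrow> real" where
  "num_at c n t = of_int (conv_num c (Suc n)) * t + of_int (conv_num c n)"

definition den_at :: "(nat \<Rightarrow> int) \<Rightarrow> nat \<Rightarrow> real \<Rightarrow> real" where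
  "den_at c n t = of_int (conv_den c (Suc n)) * t + of_int (conv_den c n)"

lemma num_at_Suc: "t \<noteq> 0 \<Longrightarrow> num_at c (Suc n) t = t * num_at c n (of_int (c (Suc n)) + 1 / t)"
  and den_at_Suc: "t \<noteq> 0 \<Longrightarrow> den_at c (Suc n) t = t * den_at c n (of_int (c (Suc n)) + 1 / t)"
  by (simp_all add: num_at_def den_at_def algebra_simps)

lemma num_at_den_at_det:
  "num_at c n s * den_at c n t - num_at c n t * den_at c n s = (-1) ^ Suc n * (s - t)"
proof -
  have "num_at c n s * den_at c n t - num_at c n t * den_at c n s
      = of_int (conv_num c (Suc n) * conv_den c n - conv_num c n * conv_den c (Suc n)) * (s - t)"
    by (simp add: num_at_def den_at_def algebra_simps)
  then show ?thesis unfolding conv_num_conv_den_det by simp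
qed

lemma abs_moebius_diff:
  assumes "den_at c n s \<noteq> 0" "den_at c n t \<noteq> 0"
  shows "\<bar>num_at c n s / den_at c n s - num_at c n t / den_at c n t\<bar>
    = \<bar>s - t\<bar> / \<bar>den_at c n s * den_at c n t\<bar>"
proof -
  have "num_at c n s / den_at c n s - num_at c n t / den_at c n t
      = (num_at c n s * den_at c n t - num_at c n t * den_at c n s) / (den_at c n s * den_at c n t)"
    using assms by (simp add: diff_frac_eq mult.commute)
  then show ?thesis by (simp add: num_at_den_at_det abs_mult)
qed

locale cfrac_digits =
  fixes c :: "nat \<Rightarrow> int"
  assumes digit_ge_1: "i \<ge> 1 \<Longrightarrow> c i \<ge> 1"
begin

lemma conv_den_mono: "conv_den c n \<le> conv_den c (Suc n)" and conv_den_nonneg: "conv_den c n \<ge> 0"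
proof -
  have "conv_den c n \<le> conv_den c (Suc n) \<and> 0 \<le> conv_den c n \<and> 0 \<le> conv_den c (Suc n)"
  proof (induction n)
    case (Suc n)
    have "1 * conv_den c (Suc n) \<le> c (Suc n) * conv_den c (Suc n)"
      using Suc by (intro mult_right_mono digit_ge_1) auto
    then show ?case using Suc by simp
  qed simp
  then show "conv_den c n \<le> conv_den c (Suc n)" "conv_den c n \<ge> 0" by blast+
qed

lemma conv_den_Suc_ge_1: "conv_den c (Suc n) \<ge> 1"
proof (induction n)
  case (Suc n)
  then show ?case using conv_den_mono[of "Suc n"] by linarith
qed simp

lemma conv_den_Suc_ge: "conv_den c (Suc n) \<ge> int n"
proof (induction n)
  case (Suc n)
  show ?case
  proof (cases n)
    case 0
    then show ?thesis using digit_ge_1[of 1] by simp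
  next
    case (Suc m)
    have "1 * conv_den c (Suc n) \<le> c (Suc n) * conv_den c (Suc n)"
      by (intro mult_right_mono digit_ge_1 conv_den_nonneg) auto
    moreover have "conv_den c n \<ge> 1" using conv_den_Suc_ge_1[of m] Suc by simp
    ultimately show ?thesis using Suc.IH conv_den.simps(3)[of c n] by linarith
  qed
qed simp

lemma den_at_ge: "t \<ge> 0 \<Longrightarrow> of_int (conv_den c (Suc n)) * t \<le> den_at c n t"
  using conv_den_nonneg[of n] by (simp add: den_at_def)

lemma den_at_pos:
  assumes "t > 0"
  shows "den_at c n t > 0"
proof -
  have "0 < of_int (conv_den c (Suc n)) * t" using conv_den_Suc_ge_1[of n] assms by simp
  then show ?thesis using den_at_ge[of t n] assms by linarith
qed

lemma cfrac_with_tail_moebius: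
  "t > 0 \<Longrightarrow> cfrac_with_tail c (Suc n) t = num_at c n t / den_at c n t"
proof (induction n arbitrary: t)
  case 0
  then show ?case by (simp add: num_at_def den_at_def add_divide_distrib)
next
  case (Suc n)
  define s where "s = of_int (c (Suc n)) + 1 / t"
  have "s > 0" using digit_ge_1[of "Suc n"] Suc.prems by (simp add: s_def add_pos_pos)
  then have "cfrac_with_tail c (Suc (Suc n)) t = num_at c n s / den_at c n s"
    using Suc.IH by (simp only: cfrac_with_tail.simps(2)[of c "Suc n"] s_def)
  moreover have "num_at c (Suc n) t = t * num_at c n s" "den_at c (Suc n) t = t * den_at c n s"
    unfolding s_def using Suc.prems by (intro num_at_Suc den_at_Suc; simp)+
  ultimately show ?case using Suc.prems by (simp del: cfrac_with_tail.simps)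
qed

lemma abs_moebius_diff_le:
  assumes "s \<ge> 1" "t \<ge> 1"
  shows "\<bar>num_at c n s / den_at c n s - num_at c n t / den_at c n t\<bar>
      \<le> 1 / (of_int (conv_den c (Suc n)))\<^sup>2"
proof -
  define q where "q = real_of_int (conv_den c (Suc n))"
  have "q \<ge> 1" using conv_den_Suc_ge_1[of n] by (simp add: q_def)
  have "s * 1 \<le> s * t" "1 * t \<le> s * t" using assms by (intro mult_mono; simp)+
  then have "\<bar>s - t\<bar> \<le> s * t" using assms by linarith
  moreover have "(q * s) * (q * t) \<le> den_at c n s * den_at c n t"
    using assms \<open>q \<ge> 1\<close> den_at_pos[of s n] unfolding q_def by (intro mult_mono den_at_ge) auto
  ultimately have "\<bar>s - t\<bar> / (den_at c n s * den_at c n t) \<le> (s * t) / ((q * s) * (q * t))"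
    using assms \<open>q \<ge> 1\<close> by (intro frac_le) auto
  also have "\<dots> = 1 / q\<^sup>2" using assms by (simp add: power2_eq_square)
  finally show ?thesis
    using den_at_pos[of s n] den_at_pos[of t n] assms by (simp add: abs_moebius_diff q_def)
qed

lemma finite_cfrac_moebius:
  assumes "Suc n < m"
  defines "t \<equiv> finite_cfrac (map c [Suc n..<m])"
  shows "t \<ge> 1" "finite_cfrac (map c [0..<m]) = num_at c n t / den_at c n t"
proof -
  show "t \<ge> 1" unfolding t_def using assms(1) by (intro finite_cfrac_ge_1) (auto intro: digit_ge_1)
  then show "finite_cfrac (map c [0..<m]) = num_at c n t / den_at c n t"
    unfolding finite_cfrac_eq_cfrac_with_tail[OF assms(1)] t_def[symmetric]
    by (intro cfrac_with_tail_moebius) simp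
qed

lemma convergent_finite_cfrac: "convergent (\<lambda>n. finite_cfrac (map c [0..<Suc n]))"
proof (rule Cauchy_convergent, rule metric_CauchyI)
  fix e :: real assume "e > 0"
  then obtain n where "n > 0" "inverse (real n) < e" using ex_inverse_of_nat_less by blast
  have "dist (finite_cfrac (map c [0..<Suc m])) (finite_cfrac (map c [0..<Suc k])) < e"
    if "Suc n \<le> m" "Suc n \<le> k" for m k
  proof -
    define q where "q = real_of_int (conv_den c (Suc n))"
    have q: "real n \<le> q" "q \<ge> 1"
      using conv_den_Suc_ge[of n] conv_den_Suc_ge_1[of n] by (simp_all add: q_def)
    have "dist (finite_cfrac (map c [0..<Suc m])) (finite_cfrac (map c [0..<Suc k])) \<le> 1 / q\<^sup>2"
      using that finite_cfrac_moebius[of n "Suc m"] finite_cfrac_moebius[of n "Suc k"]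
      by (simp add: dist_real_def q_def abs_moebius_diff_le del: upt_Suc)
    also have "\<dots> \<le> 1 / real n"
      using q \<open>n > 0\<close> self_le_power[of q 2] by (intro divide_left_mono) auto
    finally show ?thesis using \<open>inverse (real n) < e\<close> by (simp add: inverse_eq_divide)
  qed
  then show "\<exists>N. \<forall>m\<ge>N. \<forall>k\<ge>N.
      dist (finite_cfrac (map c [0..<Suc m])) (finite_cfrac (map c [0..<Suc k])) < e"
    by blast
qed

lemma finite_cfrac_LIMSEQ: "(\<lambda>n. finite_cfrac (map c [0..<Suc n])) \<longlonglongrightarrow> cfrac_value c"
  using convergent_finite_cfrac unfolding cfrac_value_def convergent_LIMSEQ_iff .

definition tail :: "nat \<Rightarrow> real" where
  "tail n = cfrac_value (\<lambda>i. c (i + n))"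

lemma shifted_digits: "cfrac_digits (\<lambda>i. c (i + n))"
  by unfold_locales (simp add: digit_ge_1)

lemma finite_cfrac_tail_LIMSEQ: "(\<lambda>m. finite_cfrac (map c [n..<m])) \<longlonglongrightarrow> tail n"
proof (rule LIMSEQ_offset[where k = "Suc n"])
  interpret shifted: cfrac_digits "\<lambda>i. c (i + n)" by (rule shifted_digits)
  have "[n..<m + Suc n] = map (\<lambda>i. i + n) [0..<Suc m]" for m
    by (simp add: map_add_upt del: upt_Suc)
  then show "(\<lambda>m. finite_cfrac (map c [n..<m + Suc n])) \<longlonglongrightarrow> tail n"
    using shifted.finite_cfrac_LIMSEQ by (simp add: tail_def comp_def del: upt_Suc)
qed

lemma tail_ge_1:
  assumes "n \<ge> 1"
  shows "tail n \<ge> 1"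
proof (rule LIMSEQ_le_const[OF finite_cfrac_tail_LIMSEQ], intro exI allI impI)
  show "1 \<le> finite_cfrac (map c [n..<m])" if "Suc n \<le> m" for m
    using assms that by (intro finite_cfrac_ge_1) (auto intro: digit_ge_1)
qed

lemma cfrac_value_eq_moebius_tail:
  "cfrac_value c = num_at c n (tail (Suc n)) / den_at c n (tail (Suc n))"
proof (rule LIMSEQ_unique)
  let ?t = "\<lambda>m. finite_cfrac (map c [Suc n..<m])"
  have "tail (Suc n) > 0" using tail_ge_1[of "Suc n"] by simp
  then have "den_at c n (tail (Suc n)) \<noteq> 0" using den_at_pos[of "tail (Suc n)" n] by linarith
  then have "(\<lambda>m. num_at c n (?t m) / den_at c n (?t m))
      \<longlonglongrightarrow> num_at c n (tail (Suc n)) / den_at c n (tail (Suc n))"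
    unfolding num_at_def den_at_def by (intro tendsto_intros finite_cfrac_tail_LIMSEQ)
  moreover have "eventually (\<lambda>m. num_at c n (?t m) / den_at c n (?t m)
      = finite_cfrac (map c [0..<m])) sequentially"
    using eventually_gt_at_top[of "Suc n"] by eventually_elim (simp add: finite_cfrac_moebius(2))
  ultimately show "(\<lambda>m. finite_cfrac (map c [0..<m]))
      \<longlonglongrightarrow> num_at c n (tail (Suc n)) / den_at c n (tail (Suc n))"
    by (rule Lim_transform_eventually)
  show "(\<lambda>m. finite_cfrac (map c [0..<m])) \<longlonglongrightarrow> cfrac_value c"
    using finite_cfrac_LIMSEQ by (rule LIMSEQ_imp_Suc)
qed

lemma tail_unfold: "tail n = of_int (c n) + 1 / tail (Suc n)"
proof -
  interpret shifted: cfrac_digits "\<lambda>i. c (i + n)" by (rule shifted_digits)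
  have "tail (Suc n) \<ge> 1" by (rule tail_ge_1) simp
  moreover have "shifted.tail 1 = tail (Suc n)" by (simp add: shifted.tail_def tail_def)
  ultimately have "tail n
      = num_at (\<lambda>i. c (i + n)) 0 (tail (Suc n)) / den_at (\<lambda>i. c (i + n)) 0 (tail (Suc n))"
    using shifted.cfrac_value_eq_moebius_tail[of 0] by (simp only: tail_def[of n] One_nat_def)
  then show ?thesis using \<open>tail (Suc n) \<ge> 1\<close> by (simp add: num_at_def den_at_def add_divide_distrib)
qed

end

section \<open>Metallic means\<close>

definition metallic_mean :: "int \<Rightarrow> real" where
  "metallic_mean a = (of_int a + sqrt ((of_int a)\<^sup>2 + 4)) / 2"

lemma metallic_mean_square: "(metallic_mean a)\<^sup>2 = of_int a * metallic_mean a + 1"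
proof -
  define s where "s = sqrt ((real_of_int a)\<^sup>2 + 4)"
  have "s\<^sup>2 = (real_of_int a)\<^sup>2 + 4" by (simp add: s_def)
  then show ?thesis
    unfolding metallic_mean_def s_def[symmetric] by (simp add: power2_eq_square field_simps)
qed

lemma metallic_mean_gt: "metallic_mean a > of_int a"
  using real_less_rsqrt[of "of_int a" "(of_int a)\<^sup>2 + 4"] by (simp add: metallic_mean_def)

lemma metallic_mean_gt_1: "a > 0 \<Longrightarrow> metallic_mean a > 1"
  using metallic_mean_gt[of a] by linarith

lemma metallic_mean_eq:
  assumes "a > 0"
  shows "metallic_mean a = of_int a + 1 / metallic_mean a"
proof -
  have "metallic_mean a * metallic_mean a = (of_int a + 1 / metallic_mean a) * metallic_mean a"
    using metallic_mean_square[of a] metallic_mean_gt_1[OF assms]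
    by (simp add: power2_eq_square distrib_right)
  then show ?thesis using metallic_mean_gt_1[OF assms] by (simp only: mult_right_cancel)
qed

lemma metallic_mean_not_in_Rats:
  assumes "a \<noteq> 0"
  shows "metallic_mean a \<notin> \<rat>"
proof
  let ?\<phi> = "metallic_mean a"
  assume "?\<phi> \<in> \<rat>"
  moreover have "algebraic_int ?\<phi>"
  proof (rule algebraic_int.intros)
    show "lead_coeff [:-1, - of_int a, 1 :: real:] = 1" by simp
    show "\<forall>i. coeff [:-1, - of_int a, 1 :: real:] i \<in> \<int>"
      by (auto simp: coeff_pCons split: nat.splits)
    show "poly [:-1, - of_int a, 1:] ?\<phi> = 0"
      using metallic_mean_square[of a] by (simp add: power2_eq_square algebra_simps)
  qed
  ultimately have "?\<phi> \<in> \<int>" using rational_algebraic_int_is_int by blast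
  then obtain k where "?\<phi> = of_int k" by (auto elim: Ints_cases)
  then have "real_of_int (k * (k - a)) = 1"
    using metallic_mean_square[of a] by (simp add: power2_eq_square algebra_simps)
  then have "k * (k - a) = 1" by linarith
  then show False using assms by (auto simp: zmult_eq_1_iff)
qed

lemma metallic_mean_digit_gap:
  assumes "a > 0"
  shows "\<exists>\<delta>>0. \<forall>b s. b \<noteq> a \<longrightarrow> 0 \<le> s \<longrightarrow> s \<le> 1 \<longrightarrow> \<delta> \<le> \<bar>of_int b + s - metallic_mean a\<bar>"
proof (intro exI conjI allI impI)
  let ?\<phi> = "metallic_mean a"
  have inverse: "0 < 1 / ?\<phi>" "1 / ?\<phi> < 1" using metallic_mean_gt_1[OF assms] by auto
  then show "min (1 / ?\<phi>) (1 - 1 / ?\<phi>) > 0" by simp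
  fix b :: int and s :: real
  assume "b \<noteq> a" "0 \<le> s" "s \<le> 1"
  then have "b + 1 \<le> a \<or> a + 1 \<le> b" by linarith
  then have "real_of_int b + 1 \<le> of_int a \<or> real_of_int a + 1 \<le> of_int b" by linarith
  then show "min (1 / ?\<phi>) (1 - 1 / ?\<phi>) \<le> \<bar>of_int b + s - ?\<phi>\<bar>"
    using metallic_mean_eq[OF assms] \<open>0 \<le> s\<close> \<open>s \<le> 1\<close> inverse by linarith
qed

section \<open>Approximation by tails of constant digits\<close>

locale metallic_approximation = cfrac_digits c for c +
  fixes a :: int
  assumes a_pos: "a > 0" and bdd_above_digits: "bdd_above (range c)"
begin

abbreviation \<xi> :: real where "\<xi> \<equiv> cfrac_value c"

abbreviation \<phi> :: real where "\<phi> \<equiv> metallic_mean a"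

definition \<phi>' :: real where "\<phi>' = - 1 / \<phi>"

abbreviation q :: "nat \<Rightarrow> real" where "q n \<equiv> of_int (conv_den c (Suc n))"

definition approximant :: "nat \<Rightarrow> real" where
  "approximant n = num_at c n \<phi> / den_at c n \<phi>"

lemma \<phi>_gt_1: "\<phi> > 1"
  by (rule metallic_mean_gt_1[OF a_pos])

lemma \<phi>'_bounds: "-1 < \<phi>'" "\<phi>' < 0"
  using \<phi>_gt_1 by (auto simp: \<phi>'_def)

lemma \<phi>_add_\<phi>': "\<phi> + \<phi>' = of_int a"
  using metallic_mean_eq[OF a_pos] by (simp add: \<phi>'_def)

lemma \<phi>_mult_\<phi>': "\<phi> * \<phi>' = -1"
  using \<phi>_gt_1 by (simp add: \<phi>'_def)

lemma \<phi>_not_in_Rats: "\<phi> \<notin> \<rat>"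
  using a_pos by (intro metallic_mean_not_in_Rats) simp

lemma q_ge_1: "q n \<ge> 1"
  using conv_den_Suc_ge_1[of n] by simp

lemma den_at_\<phi>_pos: "den_at c n \<phi> > 0"
  using \<phi>_gt_1 by (intro den_at_pos) simp

lemma den_at_\<phi>'_nonzero: "den_at c n \<phi>' \<noteq> 0"
proof
  assume "den_at c n \<phi>' = 0"
  then have "q n = of_int (conv_den c n) * \<phi>"
    using \<phi>_gt_1 by (simp add: den_at_def \<phi>'_def field_simps)
  then have "\<phi> = q n / of_int (conv_den c n)" using q_ge_1[of n] by (auto simp: field_simps)
  then show False using \<phi>_not_in_Rats by (metis Rats_divide Rats_of_int)
qed

lemma approximant_not_in_Rats: "approximant n \<notin> \<rat>"
proof -
  have "approximant n = cfrac_with_tail c (Suc n) \<phi>"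
    using \<phi>_gt_1 cfrac_with_tail_moebius[of \<phi> n] by (simp add: approximant_def)
  then show ?thesis
    using \<phi>_not_in_Rats by (simp add: cfrac_with_tail_in_Rats_iff del: cfrac_with_tail.simps)
qed

lemma digit_Suc_eq_a:
  assumes "c (Suc n) = a"
  shows "den_at c (Suc n) \<phi> = \<phi> * den_at c n \<phi>" "approximant (Suc n) = approximant n"
proof -
  have eq: "of_int (c (Suc n)) + 1 / \<phi> = \<phi>" using metallic_mean_eq[OF a_pos] assms by simp
  then show "den_at c (Suc n) \<phi> = \<phi> * den_at c n \<phi>" using den_at_Suc[of \<phi> c n] \<phi>_gt_1 by simp
  then show "approximant (Suc n) = approximant n"
    using num_at_Suc[of \<phi> c n] eq \<phi>_gt_1 by (simp add: approximant_def)
qed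

subsection \<open>Sizes of the denominators\<close>

lemma digits_bounded: "\<exists>B\<ge>1. \<forall>n. of_int (c n) \<le> (B :: real)"
proof -
  obtain B where "\<And>n. c n \<le> B" using bdd_above_digits by (auto simp: bdd_above_def)
  then have "of_int (c n) \<le> real_of_int (max 1 B)" for n by (simp add: max.coboundedI2)
  then show ?thesis by (intro exI[of _ "real_of_int (max 1 B)"]) auto
qed

lemma tail_bounded: "\<exists>R. \<forall>n\<ge>1. 1 \<le> tail n \<and> tail n \<le> R"
proof -
  obtain B where B: "\<And>n. of_int (c n) \<le> (B :: real)" using digits_bounded by blast
  have "tail n \<le> B + 1" if "n \<ge> 1" for n
    using tail_unfold[of n] tail_ge_1[of "Suc n"] B[of n]
    by (smt (verit) le_add1 plus_1_eq_Suc divide_le_eq_1)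
  then show ?thesis using tail_ge_1 by blast
qed

lemma q_Suc_bigtheta: "(\<lambda>n. q (Suc n)) \<in> \<Theta>[principal UNIV](q)"
proof (rule bigthetaI)
  obtain B where "B \<ge> 1" and B: "\<And>n. of_int (c n) \<le> (B :: real)" using digits_bounded by blast
  have "q (Suc n) \<le> (B + 1) * q n" for n
  proof -
    have "q (Suc n) = of_int (c (Suc n)) * q n + of_int (conv_den c n)" by simp
    also have "\<dots> \<le> B * q n + q n"
      using B[of "Suc n"] q_ge_1[of n] conv_den_mono[of n] by (intro add_mono mult_right_mono) auto
    finally show ?thesis by (simp add: algebra_simps)
  qed
  then show "(\<lambda>n. q (Suc n)) \<in> O[principal UNIV](q)"
    using q_ge_1 order_trans[OF zero_le_one q_ge_1]
    by (intro bigoI[of _ "B + 1"]) (simp del: conv_den.simps)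
  show "(\<lambda>n. q (Suc n)) \<in> \<Omega>[principal UNIV](q)"
    using conv_den_mono conv_den_nonneg
    by (intro bigomega_principalI[of 1]) (simp_all del: conv_den.simps)
qed

lemma den_at_bigtheta:
  assumes "\<And>n. 1 \<le> t n" "\<And>n. t n \<le> R"
  shows "(\<lambda>n. den_at c n (t n)) \<in> \<Theta>[principal UNIV](q)"
proof (rule bigthetaI)
  have den_at_pos: "den_at c n (t n) > 0" for n using assms(1)[of n] by (intro den_at_pos) simp
  have "den_at c n (t n) \<le> (R + 1) * q n" for n
  proof -
    have "den_at c n (t n) \<le> q n * R + q n"
      unfolding den_at_def using assms(2)[of n] q_ge_1[of n] conv_den_mono[of n]
      by (intro add_mono mult_left_mono) auto
    then show ?thesis by (simp add: algebra_simps)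
  qed
  then show "(\<lambda>n. den_at c n (t n)) \<in> O[principal UNIV](q)"
    using den_at_pos conv_den_nonneg by (intro bigoI[of _ "R + 1"]) (simp add: less_imp_le)
  have "q n \<le> den_at c n (t n)" for n
  proof -
    have "q n * 1 \<le> q n * t n" using assms(1)[of n] q_ge_1[of n] by (intro mult_left_mono) auto
    also have "\<dots> \<le> den_at c n (t n)" using assms(1)[of n] by (intro den_at_ge) simp
    finally show ?thesis by simp
  qed
  then show "(\<lambda>n. den_at c n (t n)) \<in> \<Omega>[principal UNIV](q)"
    using den_at_pos conv_den_nonneg
    by (intro bigomega_principalI[of 1]) (simp_all add: less_imp_le)
qed

lemma den_at_\<phi>_bigtheta: "(\<lambda>n. den_at c n \<phi>) \<in> \<Theta>[principal UNIV](q)"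
  using \<phi>_gt_1 by (intro den_at_bigtheta[where R = \<phi>]) auto

lemma den_at_tail_bigtheta: "(\<lambda>n. den_at c n (tail (Suc n))) \<in> \<Theta>[principal UNIV](q)"
proof -
  obtain R where "\<And>n. n \<ge> 1 \<Longrightarrow> 1 \<le> tail n \<and> tail n \<le> R" using tail_bounded by blast
  then show ?thesis by (intro den_at_bigtheta[where R = R]) auto
qed

lemma abs_den_at_\<phi>'_le: "\<bar>den_at c n \<phi>'\<bar> \<le> 2 * q n"
proof -
  have "\<bar>den_at c n \<phi>'\<bar> \<le> q n * \<bar>\<phi>'\<bar> + of_int (conv_den c n)"
    using conv_den_nonneg[of n] conv_den_nonneg[of "Suc n"]
      abs_triangle_ineq[of "q n * \<phi>'" "of_int (conv_den c n)"] by (simp add: den_at_def abs_mult)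
  also have "\<dots> \<le> q n * 1 + q n"
    using \<phi>'_bounds conv_den_mono[of n] q_ge_1[of n] by (intro add_mono mult_left_mono) auto
  finally show ?thesis by simp
qed

lemma den_at_\<phi>'_bigtheta: "(\<lambda>n. den_at c n \<phi>') \<in> \<Theta>[principal {n. n \<ge> 1 \<and> c n \<noteq> a}](q)"
proof (rule bigthetaI)
  show "(\<lambda>n. den_at c n \<phi>') \<in> O[principal {n. n \<ge> 1 \<and> c n \<noteq> a}](q)"
    using abs_den_at_\<phi>'_le conv_den_nonneg by (intro bigoI[of _ 2]) (simp add: eventually_principal)
  obtain \<delta> where "\<delta> > 0" and \<delta>: "\<And>b s. b \<noteq> a \<Longrightarrow> 0 \<le> s \<Longrightarrow> s \<le> 1 \<Longrightarrow> \<delta> \<le> \<bar>of_int b + s - \<phi>\<bar>"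
    using metallic_mean_digit_gap[OF a_pos] by blast
  obtain C where "C > 0" and C: "\<And>n. q (Suc n) \<le> C * q n"
    using bigthetaD1[OF q_Suc_bigtheta] conv_den_nonneg
    by (elim landau_o.bigE) (auto simp del: conv_den.simps)
  show "(\<lambda>n. den_at c n \<phi>') \<in> \<Omega>[principal {n. n \<ge> 1 \<and> c n \<noteq> a}](q)"
  proof (rule bigomega_principalI)
    show "\<delta> / (C * \<phi>) > 0" using \<open>\<delta> > 0\<close> \<open>C > 0\<close> \<phi>_gt_1 by simp
    fix n assume "n \<in> {n. n \<ge> 1 \<and> c n \<noteq> a}"
    then obtain m where n: "n = Suc m" "c (Suc m) \<noteq> a" by (cases n) auto
    define s where "s = of_int (conv_den c m) / q m"
    have "0 \<le> s" "s \<le> 1"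
      using conv_den_nonneg[of m] conv_den_mono[of m] q_ge_1[of m] by (auto simp: s_def)
    have "q m * s = of_int (conv_den c m)" using q_ge_1[of m] by (simp add: s_def)
    then have q_n: "q n = q m * (of_int (c n) + s)" by (simp add: n(1) distrib_left mult.commute)
    have "\<phi> * den_at c n \<phi>' = \<phi> * \<phi>' * q n + \<phi> * q m"
      by (simp add: den_at_def n(1) algebra_simps)
    also have "\<dots> = - (q m * (of_int (c n) + s - \<phi>))"
      unfolding \<phi>_mult_\<phi>' q_n by (simp add: algebra_simps)
    finally have "\<phi> * \<bar>den_at c n \<phi>'\<bar> = q m * \<bar>of_int (c n) + s - \<phi>\<bar>"
      using q_ge_1[of m] \<phi>_gt_1
      by (metis abs_minus abs_mult abs_of_nonneg le_less_trans less_imp_le zero_le_one order_trans)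
    moreover have "q m * \<delta> \<le> q m * \<bar>of_int (c n) + s - \<phi>\<bar>"
      using \<delta>[of "c n" s] n \<open>0 \<le> s\<close> \<open>s \<le> 1\<close> q_ge_1[of m] by (intro mult_left_mono) auto
    moreover have "q n * \<delta> \<le> C * q m * \<delta>" using C[of m] \<open>\<delta> > 0\<close> by (simp add: n(1))
    moreover from calculation have "C * (q m * \<delta>) \<le> C * (\<phi> * \<bar>den_at c n \<phi>'\<bar>)"
      using \<open>C > 0\<close> by (intro mult_left_mono) auto
    ultimately have "q n * \<delta> \<le> C * (\<phi> * \<bar>den_at c n \<phi>'\<bar>)" by simp
    then show "\<delta> / (C * \<phi>) * \<bar>q n\<bar> \<le> \<bar>den_at c n \<phi>'\<bar>"
      using \<open>C > 0\<close> \<phi>_gt_1 q_ge_1[of n] by (simp add: field_simps)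
  qed
qed

subsection \<open>The minimal polynomials of the approximants\<close>

text \<open>The Moebius map \<open>t \<mapsto> num_at c n t / den_at c n t\<close> sends \<open>\<phi>\<close> to the approximant. Substituting
  its inverse \<open>N / D\<close> into \<open>X\<^sup>2 - a X - 1\<close>, whose roots are \<open>\<phi>\<close> and \<open>\<phi>'\<close>, and multiplying by \<open>D\<^sup>2\<close>
  gives a polynomial that vanishes there.\<close>

definition approx_poly :: "nat \<Rightarrow> int poly" where
  "approx_poly n =
    (let N = [:- conv_num c n, conv_den c n:]; D = [:conv_num c (Suc n), - conv_den c (Suc n):]
     in N ^ 2 - smult a (N * D) - D ^ 2)"

definition approx_min_poly :: "nat \<Rightarrow> int poly" where
  "approx_min_poly n = smult (sgn (lead_coeff (approx_poly n))) (approx_poly n)"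

lemma approx_poly_eq:
  fixes n :: nat
  defines "p \<equiv> conv_num c (Suc n)" and "p' \<equiv> conv_num c n"
    and "r \<equiv> conv_den c (Suc n)" and "r' \<equiv> conv_den c n"
  shows "approx_poly n = [:p'\<^sup>2 + a * p * p' - p\<^sup>2, 2 * p * r - 2 * p' * r' - a * (p * r' + p' * r),
    r'\<^sup>2 + a * r * r' - r\<^sup>2:]"
  by (simp add: approx_poly_def Let_def p_def p'_def r_def r'_def power2_eq_square algebra_simps)

lemma map_poly_approx_poly:
  "map_poly real_of_int (approx_poly n)
    = [:- num_at c n \<phi>, den_at c n \<phi>:] * [:- num_at c n \<phi>', den_at c n \<phi>':]"
proof -
  define p p' r r' where "p = real_of_int (conv_num c (Suc n))"
    and "p' = real_of_int (conv_num c n)"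
    and "r = real_of_int (conv_den c (Suc n))" and "r' = real_of_int (conv_den c n)"
  have expand: "(x * \<phi> + y) * (z * \<phi>' + u) = y * u + x * u * \<phi> + z * y * \<phi>' - x * z" for x y z u
  proof -
    have "(x * \<phi> + y) * (z * \<phi>' + u) = y * u + x * u * \<phi> + z * y * \<phi>' + x * z * (\<phi> * \<phi>')"
      by (simp add: algebra_simps)
    then show ?thesis by (simp add: \<phi>_mult_\<phi>')
  qed
  have "map_poly real_of_int (approx_poly n)
      = [:p'\<^sup>2 + of_int a * p * p' - p\<^sup>2, 2 * p * r - 2 * p' * r' - of_int a * (p * r' + p' * r),
         r'\<^sup>2 + of_int a * r * r' - r\<^sup>2:]"
    by (simp add: approx_poly_eq of_int_hom.map_poly_pCons_hom p_def p'_def r_def r'_def)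
  also have "p'\<^sup>2 + of_int a * p * p' - p\<^sup>2 = (p * \<phi> + p') * (p * \<phi>' + p')"
    unfolding expand \<phi>_add_\<phi>'[symmetric] by (simp add: algebra_simps power2_eq_square)
  also have "2 * p * r - 2 * p' * r' - of_int a * (p * r' + p' * r)
      = - ((r * \<phi> + r') * (p * \<phi>' + p') + (p * \<phi> + p') * (r * \<phi>' + r'))"
    unfolding expand \<phi>_add_\<phi>'[symmetric] by (simp add: algebra_simps)
  also have "r'\<^sup>2 + of_int a * r * r' - r\<^sup>2 = (r * \<phi> + r') * (r * \<phi>' + r')"
    unfolding expand \<phi>_add_\<phi>'[symmetric] by (simp add: algebra_simps power2_eq_square)
  also have "[:(p * \<phi> + p') * (p * \<phi>' + p'),
        - ((r * \<phi> + r') * (p * \<phi>' + p') + (p * \<phi> + p') * (r * \<phi>' + r')),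
          (r * \<phi> + r') * (r * \<phi>' + r'):]
      = [:- (p * \<phi> + p'), r * \<phi> + r':] * [:- (p * \<phi>' + p'), r * \<phi>' + r':]"
    by (simp add: algebra_simps)
  finally show ?thesis
    unfolding num_at_def den_at_def p_def p'_def r_def r'_def .
qed

lemma degree_approx_poly: "degree (approx_poly n) = 2"
proof -
  have "degree (map_poly real_of_int (approx_poly n)) = 2"
    unfolding map_poly_approx_poly using den_at_\<phi>_pos[of n] den_at_\<phi>'_nonzero[of n]
    by (subst degree_mult_eq) auto
  then show ?thesis by simp
qed

lemma lead_coeff_approx_poly: "of_int (lead_coeff (approx_poly n)) = den_at c n \<phi> * den_at c n \<phi>'"
proof -
  have "of_int (lead_coeff (approx_poly n)) = lead_coeff (map_poly real_of_int (approx_poly n))"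
    by simp
  also have "\<dots> = den_at c n \<phi> * den_at c n \<phi>'"
    unfolding map_poly_approx_poly lead_coeff_mult
    using den_at_\<phi>_pos[of n] den_at_\<phi>'_nonzero[of n] by simp
  finally show ?thesis .
qed

lemma rpoly_approx_poly:
  "rpoly (approx_poly n) x
    = (den_at c n \<phi> * x - num_at c n \<phi>) * (den_at c n \<phi>' * x - num_at c n \<phi>')"
  unfolding map_poly_approx_poly by (simp add: algebra_simps)

lemma content_approx_poly: "Polynomial.content (approx_poly n) = 1"
proof -
  define p p' r r' where "p = conv_num c (Suc n)" and "p' = conv_num c n"
    and "r = conv_den c (Suc n)" and "r' = conv_den c n"
  have poly_eq: "approx_poly n = [:p'\<^sup>2 + a * p * p' - p\<^sup>2,
      2 * p * r - 2 * p' * r' - a * (p * r' + p' * r),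
      r'\<^sup>2 + a * r * r' - r\<^sup>2:]"
    by (simp add: approx_poly_eq p_def p'_def r_def r'_def)
  let ?P = "approx_poly n"
  have "Polynomial.content ?P dvd coeff ?P 0 * r'\<^sup>2 + coeff ?P 1 * (p' * r') + coeff ?P 2 * p'\<^sup>2"
    by (intro dvd_add dvd_mult2 content_dvd_coeff)
  also have "coeff ?P 0 * r'\<^sup>2 + coeff ?P 1 * (p' * r') + coeff ?P 2 * p'\<^sup>2
      = - ((p * r' - p' * r)\<^sup>2)"
    unfolding poly_eq by (simp add: numeral_2_eq_2 algebra_simps)
  also have "(p * r' - p' * r)\<^sup>2 = 1"
    unfolding p_def p'_def r_def r'_def conv_num_conv_den_det by (simp flip: power_mult)
  finally show ?thesis by (intro iffD1[OF is_unit_content_iff]) simp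
qed

lemma lead_coeff_approx_poly_nonzero: "lead_coeff (approx_poly n) \<noteq> 0"
  by (metis degree_0 degree_approx_poly leading_coeff_0_iff zero_neq_numeral)

lemma sgn_lead_coeff_approx_poly: "\<bar>sgn (lead_coeff (approx_poly n))\<bar> = 1"
  using lead_coeff_approx_poly_nonzero by (simp only: abs_sgn_eq if_False)

lemma degree_approx_min_poly: "degree (approx_min_poly n) = 2"
  using lead_coeff_approx_poly_nonzero[of n]
  by (simp add: approx_min_poly_def degree_approx_poly sgn_eq_0_iff)

lemma poly_height_approx_min_poly: "poly_height (approx_min_poly n) = poly_height (approx_poly n)"
  using sgn_lead_coeff_approx_poly[of n]
  by (simp add: poly_height_def degree_approx_min_poly degree_approx_poly)
    (simp add: approx_min_poly_def abs_mult)

lemma abs_rpoly_approx_min_poly: "\<bar>rpoly (approx_min_poly n) x\<bar> = \<bar>rpoly (approx_poly n) x\<bar>"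
proof -
  have "\<bar>real_of_int (sgn (lead_coeff (approx_poly n)))\<bar> = 1"
    unfolding of_int_abs[symmetric] sgn_lead_coeff_approx_poly by simp
  then show ?thesis by (simp add: approx_min_poly_def of_int_hom.map_poly_hom_smult abs_mult)
qed

lemma is_int_min_poly_approximant: "is_int_min_poly (approximant n) (approx_min_poly n)"
proof (rule is_int_min_poly_quadratic)
  have "rpoly (approx_poly n) (approximant n) = 0"
    using den_at_\<phi>_pos[of n] by (simp add: rpoly_approx_poly approximant_def)
  then show "rpoly (approx_min_poly n) (approximant n) = 0"
    using abs_rpoly_approx_min_poly[of n "approximant n"] by simp
  show "Polynomial.content (approx_min_poly n) = 1"
    using sgn_lead_coeff_approx_poly[of n]
    by (simp add: approx_min_poly_def content_smult content_approx_poly)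
  have "lead_coeff (approx_min_poly n) = \<bar>lead_coeff (approx_poly n)\<bar>"
    by (simp add: approx_min_poly_def lead_coeff_smult sgn_mult_self_eq abs_sgn mult.commute)
  then show "lead_coeff (approx_min_poly n) > 0" using lead_coeff_approx_poly_nonzero[of n] by simp
qed (rule degree_approx_min_poly approximant_not_in_Rats)+

subsection \<open>Distances and heights\<close>

lemma den_at_tail_pos: "den_at c n (tail (Suc n)) > 0"
  using tail_ge_1[of "Suc n"] by (intro den_at_pos) simp

lemma abs_den_at_mult_\<xi>:
  "\<bar>den_at c n s * \<xi> - num_at c n s\<bar> = \<bar>tail (Suc n) - s\<bar> / den_at c n (tail (Suc n))"
proof -
  let ?t = "tail (Suc n)"
  have "den_at c n ?t > 0" by (rule den_at_tail_pos)
  then have "num_at c n ?t = \<xi> * den_at c n ?t" by (simp add: cfrac_value_eq_moebius_tail[of n])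
  then have "(den_at c n s * \<xi> - num_at c n s) * den_at c n ?t
      = num_at c n ?t * den_at c n s - num_at c n s * den_at c n ?t"
    by (simp add: algebra_simps)
  also have "\<dots> = (-1) ^ Suc n * (?t - s)" by (rule num_at_den_at_det)
  finally have "den_at c n s * \<xi> - num_at c n s = (-1) ^ Suc n * (?t - s) / den_at c n ?t"
    using \<open>den_at c n ?t > 0\<close> by (intro iffD2[OF nonzero_eq_divide_eq]) auto
  then show ?thesis using \<open>den_at c n ?t > 0\<close> by (simp add: abs_mult power_abs)
qed

lemma abs_dist_approximant:
  "\<bar>\<xi> - approximant n\<bar> = \<bar>tail (Suc n) - \<phi>\<bar> / (den_at c n (tail (Suc n)) * den_at c n \<phi>)"
proof -
  have "den_at c n \<phi> * \<xi> - num_at c n \<phi> = den_at c n \<phi> * (\<xi> - approximant n)"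
    using den_at_\<phi>_pos[of n] by (simp add: approximant_def right_diff_distrib)
  then have "\<bar>den_at c n \<phi> * \<xi> - num_at c n \<phi>\<bar> = den_at c n \<phi> * \<bar>\<xi> - approximant n\<bar>"
    using den_at_\<phi>_pos[of n] by (simp add: abs_mult)
  then show ?thesis
    using den_at_\<phi>_pos[of n] den_at_tail_pos[of n] unfolding abs_den_at_mult_\<xi>
    by (simp add: nonzero_eq_divide_eq nonzero_divide_eq_eq mult_ac)
qed

lemma tail_diff_\<phi>_bigtheta: "(\<lambda>n. tail (Suc n) - \<phi>) \<in> \<Theta>[principal {n. c (Suc n) \<noteq> a}](\<lambda>_. 1)"
proof (rule bigthetaI)
  obtain R where R: "\<And>n. n \<ge> 1 \<Longrightarrow> 1 \<le> tail n \<and> tail n \<le> R" using tail_bounded by blast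
  have "\<bar>tail (Suc n) - \<phi>\<bar> \<le> R + \<phi>" for n using R[of "Suc n"] \<phi>_gt_1 by (simp add: abs_le_iff)
  then show "(\<lambda>n. tail (Suc n) - \<phi>) \<in> O[principal {n. c (Suc n) \<noteq> a}](\<lambda>_. 1)"
    by (intro bigoI[of _ "R + \<phi>"]) (simp add: eventually_principal)
  obtain \<delta> where "\<delta> > 0" and \<delta>: "\<And>b s. b \<noteq> a \<Longrightarrow> 0 \<le> s \<Longrightarrow> s \<le> 1 \<Longrightarrow> \<delta> \<le> \<bar>of_int b + s - \<phi>\<bar>"
    using metallic_mean_digit_gap[OF a_pos] by blast
  show "(\<lambda>n. tail (Suc n) - \<phi>) \<in> \<Omega>[principal {n. c (Suc n) \<noteq> a}](\<lambda>_. 1)"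
  proof (rule bigomega_principalI[OF \<open>\<delta> > 0\<close>])
    fix n assume "n \<in> {n. c (Suc n) \<noteq> a}"
    then show "\<delta> * \<bar>1\<bar> \<le> \<bar>tail (Suc n) - \<phi>\<bar>"
      using \<delta>[of "c (Suc n)" "1 / tail (Suc (Suc n))"] tail_ge_1[of "Suc (Suc n)"]
      unfolding tail_unfold[of "Suc n"] by simp
  qed
qed

lemma dist_approximant_bigtheta:
  "(\<lambda>n. \<xi> - approximant n) \<in> \<Theta>[principal {n. c (Suc n) \<noteq> a}](\<lambda>n. 1 / (q n)\<^sup>2)"
proof -
  let ?S = "{n. c (Suc n) \<noteq> a}"
  have "principal ?S \<le> principal UNIV" by simp
  note den_at = landau_theta.filter_mono[OF this den_at_tail_bigtheta]
    landau_theta.filter_mono[OF this den_at_\<phi>_bigtheta]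
  have "(\<lambda>n. (tail (Suc n) - \<phi>) / (den_at c n (tail (Suc n)) * den_at c n \<phi>))
      \<in> \<Theta>[principal ?S](\<lambda>n. 1 / (q n * q n))"
    by (intro bigtheta_divide_principal landau_theta.mult tail_diff_\<phi>_bigtheta den_at)
  moreover have "\<bar>\<xi> - approximant n\<bar>
      = \<bar>(tail (Suc n) - \<phi>) / (den_at c n (tail (Suc n)) * den_at c n \<phi>)\<bar>" for n
    using abs_dist_approximant[of n] den_at_\<phi>_pos[of n] den_at_tail_pos[of n]
    by (simp add: abs_divide abs_mult)
  ultimately show ?thesis
    by (metis (no_types, lifting) ext landau_theta.abs_in_iff power2_eq_square)
qed

lemma rpoly_approx_min_poly_bigtheta:
  "(\<lambda>n. rpoly (approx_min_poly n) \<xi>) \<in> \<Theta>[principal UNIV](\<lambda>n. \<xi> - approximant n)"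
proof -
  have tail_diff: "(\<lambda>n. tail (Suc n) - \<phi>') \<in> \<Theta>[principal UNIV](\<lambda>_. 1)"
  proof (rule bigthetaI)
    obtain R where R: "\<And>n. n \<ge> 1 \<Longrightarrow> 1 \<le> tail n \<and> tail n \<le> R" using tail_bounded by blast
    have tail_diff: "1 \<le> tail (Suc n) - \<phi>'" "tail (Suc n) - \<phi>' \<le> R + 1" for n
      using R[of "Suc n"] \<phi>'_bounds by auto
    then have abs_tail_diff: "\<bar>tail (Suc n) - \<phi>'\<bar> = tail (Suc n) - \<phi>'" for n
      using tail_diff(1)[of n] by linarith
    show "(\<lambda>n. tail (Suc n) - \<phi>') \<in> O[principal UNIV](\<lambda>_. 1)"
      using tail_diff(2) by (intro bigoI[of _ "R + 1"]) (simp add: abs_tail_diff)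
    show "(\<lambda>n. tail (Suc n) - \<phi>') \<in> \<Omega>[principal UNIV](\<lambda>_. 1)"
      using tail_diff(1) by (intro bigomega_principalI[of 1]) (simp_all add: abs_tail_diff)
  qed
  have "(\<lambda>n. den_at c n \<phi> * (tail (Suc n) - \<phi>') / den_at c n (tail (Suc n)))
      \<in> \<Theta>[principal UNIV](\<lambda>n. q n * 1 / q n)"
    by (intro bigtheta_divide_principal landau_theta.mult tail_diff den_at_tail_bigtheta
      den_at_\<phi>_bigtheta)
  moreover have "q n * 1 / q n = 1" for n using q_ge_1[of n] by simp
  ultimately have factor: "(\<lambda>n. den_at c n \<phi> * (tail (Suc n) - \<phi>') / den_at c n (tail (Suc n)))
      \<in> \<Theta>[principal UNIV](\<lambda>_. 1)"
    by simp
  have "\<bar>rpoly (approx_min_poly n) \<xi>\<bar>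
      = \<bar>(\<xi> - approximant n) * (den_at c n \<phi> * (tail (Suc n) - \<phi>') / den_at c n (tail (Suc n)))\<bar>"
    for n
    unfolding abs_rpoly_approx_min_poly rpoly_approx_poly abs_mult abs_divide abs_den_at_mult_\<xi>
      abs_dist_approximant
    using den_at_\<phi>_pos[of n] den_at_tail_pos[of n] by simp
  then have "(\<lambda>n. \<bar>rpoly (approx_min_poly n) \<xi>\<bar>) \<in> \<Theta>[principal UNIV](\<lambda>n. (\<xi> - approximant n) * 1)"
    using landau_theta.mult[OF bigtheta_refl factor, of "\<lambda>n. \<xi> - approximant n"]
    by (simp only: landau_theta.abs_in_iff)
  then show ?thesis by simp
qed

lemma den_at_num_at_bounded:
  "\<exists>C. \<forall>n. \<forall>s\<in>{\<phi>, \<phi>'}. \<bar>den_at c n s\<bar> \<le> C * q n \<and> \<bar>num_at c n s\<bar> \<le> C * q n"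
proof -
  obtain R where R: "\<And>n. n \<ge> 1 \<Longrightarrow> 1 \<le> tail n \<and> tail n \<le> R" using tail_bounded by blast
  obtain A where A: "\<And>n. \<bar>den_at c n \<phi>\<bar> \<le> A * q n"
    using bigthetaD1[OF den_at_\<phi>_bigtheta] conv_den_nonneg by (elim landau_o.bigE) auto
  define B where "B = max A 2"
  have den: "\<bar>den_at c n s\<bar> \<le> B * q n" if "s \<in> {\<phi>, \<phi>'}" for n s
    using that A[of n] abs_den_at_\<phi>'_le[of n] q_ge_1[of n] mult_right_mono[of _ B "q n"]
    by (auto simp: B_def intro: order_trans)
  have num: "\<bar>num_at c n s\<bar> \<le> (B * \<bar>\<xi>\<bar> + R + \<phi>) * q n" if "s \<in> {\<phi>, \<phi>'}" for n s
  proof -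
    have "q n * 1 \<le> q n * tail (Suc n)"
      using R[of "Suc n"] q_ge_1[of n] by (intro mult_left_mono) auto
    also have "\<dots> \<le> den_at c n (tail (Suc n))" using R[of "Suc n"] by (intro den_at_ge) auto
    finally have "1 \<le> den_at c n (tail (Suc n))" using q_ge_1[of n] by linarith
    then have "\<bar>tail (Suc n) - s\<bar> / den_at c n (tail (Suc n)) \<le> \<bar>tail (Suc n) - s\<bar>"
      by (simp add: divide_le_eq mult_le_cancel_left1)
    also have "\<dots> \<le> (R + \<phi>) * 1" using that R[of "Suc n"] \<phi>_gt_1 \<phi>'_bounds by (auto simp: abs_le_iff)
    also have "\<dots> \<le> (R + \<phi>) * q n"
      using q_ge_1[of n] R[of 1] \<phi>_gt_1 by (intro mult_left_mono) auto
    finally have "\<bar>den_at c n s * \<xi> - num_at c n s\<bar> \<le> (R + \<phi>) * q n"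
      by (simp only: abs_den_at_mult_\<xi>)
    moreover have "\<bar>den_at c n s * \<xi>\<bar> \<le> B * q n * \<bar>\<xi>\<bar>"
      unfolding abs_mult by (intro mult_right_mono den that) auto
    ultimately show ?thesis by (simp add: algebra_simps)
  qed
  define C where "C = max B (B * \<bar>\<xi>\<bar> + R + \<phi>)"
  have C: "B * q n \<le> C * q n" "(B * \<bar>\<xi>\<bar> + R + \<phi>) * q n \<le> C * q n" for n
    using q_ge_1[of n] by (intro mult_right_mono; simp add: C_def)+
  have "\<bar>den_at c n s\<bar> \<le> C * q n \<and> \<bar>num_at c n s\<bar> \<le> C * q n" if "s \<in> {\<phi>, \<phi>'}" for n s
    using order_trans[OF den[OF that] C(1)] order_trans[OF num[OF that] C(2)] by blast
  then show ?thesis by blast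
qed

lemma poly_height_approx_min_poly_bigtheta:
  "(\<lambda>n. of_int (poly_height (approx_min_poly n))) \<in> \<Theta>[principal {n. n \<ge> 1 \<and> c n \<noteq> a}](\<lambda>n. (q n)\<^sup>2)"
proof (rule bigthetaI)
  let ?S = "{n. n \<ge> 1 \<and> c n \<noteq> a}"
  obtain C where "\<And>n s. s \<in> {\<phi>, \<phi>'} \<Longrightarrow> \<bar>den_at c n s\<bar> \<le> C * q n \<and> \<bar>num_at c n s\<bar> \<le> C * q n"
    using den_at_num_at_bounded by blast
  then have "real_of_int (poly_height (approx_min_poly n)) \<le> 2 * (C * q n)\<^sup>2" for n
    unfolding poly_height_approx_min_poly
    by (intro poly_height_le_if_linear_factors[OF map_poly_approx_poly]) auto
  then show "(\<lambda>n. of_int (poly_height (approx_min_poly n))) \<in> O[principal ?S](\<lambda>n. (q n)\<^sup>2)"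
    by (intro bigoI[of _ "2 * C\<^sup>2"])
      (simp add: power_mult_distrib poly_height_nonneg eventually_principal mult.assoc)
  have "principal ?S \<le> principal UNIV" by simp
  then have "(\<lambda>n. den_at c n \<phi> * den_at c n \<phi>') \<in> \<Omega>[principal ?S](\<lambda>n. q n * q n)"
    by (intro bigthetaD2 landau_theta.mult den_at_\<phi>'_bigtheta
      landau_theta.filter_mono[OF _ den_at_\<phi>_bigtheta])
  moreover have "\<bar>den_at c n \<phi> * den_at c n \<phi>'\<bar> \<le> of_int (poly_height (approx_min_poly n))" for n
    unfolding poly_height_approx_min_poly lead_coeff_approx_poly[symmetric]
    by (rule abs_of_int_coeff_le_poly_height)
  then have "(\<lambda>n. of_int (poly_height (approx_min_poly n)))
      \<in> \<Omega>[principal ?S](\<lambda>n. den_at c n \<phi> * den_at c n \<phi>')"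
    by (intro bigomega_principalI[of 1]) (simp_all add: poly_height_nonneg)
  ultimately show "(\<lambda>n. of_int (poly_height (approx_min_poly n))) \<in> \<Omega>[principal ?S](\<lambda>n. (q n)\<^sup>2)"
    unfolding power2_eq_square using landau_omega.big_trans by blast
qed

subsection \<open>Growth of the denominators\<close>

lemma ln_den_at_Suc_bounded: "\<exists>E. \<forall>n. \<bar>ln (den_at c (Suc n) \<phi>) - ln (den_at c n \<phi>)\<bar> \<le> E"
proof -
  have "(\<lambda>n. den_at c (Suc n) \<phi>) \<in> \<Theta>[principal UNIV](\<lambda>n. q (Suc n))"
    using den_at_\<phi>_bigtheta by (rule landau_theta.compose) simp
  also note q_Suc_bigtheta
  also have "q \<in> \<Theta>[principal UNIV](\<lambda>n. den_at c n \<phi>)"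
    using den_at_\<phi>_bigtheta by (simp only: bigtheta_sym)
  finally show ?thesis
    using bigtheta_ln_diff_bounded[of "\<lambda>n. den_at c (Suc n) \<phi>" UNIV "\<lambda>n. den_at c n \<phi>"] den_at_\<phi>_pos
    by blast
qed

lemma ln_den_at_approx:
  "\<exists>E\<ge>0. \<forall>n. \<bar>ln (den_at c n \<phi>) - real n * ln \<phi>\<bar>
      \<le> E * (1 + real (card {i. 1 \<le> i \<and> i \<le> n \<and> c i \<noteq> a}))"
proof -
  define e where "e n = ln (den_at c n \<phi>) - real n * ln \<phi>" for n
  obtain E where E: "\<And>n. \<bar>ln (den_at c (Suc n) \<phi>) - ln (den_at c n \<phi>)\<bar> \<le> E"
    using ln_den_at_Suc_bounded by blast
  define E' where "E' = \<bar>e 0\<bar> + E + ln \<phi>"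
  have "ln \<phi> > 0" using \<phi>_gt_1 by simp
  have "E \<ge> 0" using E[of 0] by linarith
  have "\<bar>e n\<bar> \<le> E' * (1 + real (card {i. 1 \<le> i \<and> i \<le> n \<and> c i \<noteq> a}))" for n
  proof (induction n)
    case 0
    have "\<bar>e 0\<bar> * 1 \<le> E' * (1 + real (card {i. 1 \<le> i \<and> i \<le> 0 \<and> c i \<noteq> a}))"
      using \<open>E \<ge> 0\<close> \<open>ln \<phi> > 0\<close> by (intro mult_mono) (auto simp: E'_def)
    then show ?case by simp
  next
    case (Suc n)
    let ?A = "\<lambda>n. {i. 1 \<le> i \<and> i \<le> n \<and> c i \<noteq> a}"
    show ?case
    proof (cases "c (Suc n) = a")
      case True
      then have "?A (Suc n) = ?A n" by (auto simp: le_Suc_eq)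
      moreover have "e (Suc n) = e n"
        using digit_Suc_eq_a(1)[OF True] den_at_\<phi>_pos[of n] \<phi>_gt_1
        by (simp add: e_def ln_mult algebra_simps)
      ultimately show ?thesis using Suc by simp
    next
      case False
      then have "?A (Suc n) = insert (Suc n) (?A n)" by (auto simp: le_Suc_eq)
      then have "card (?A (Suc n)) = Suc (card (?A n))" by simp
      moreover have "\<bar>e (Suc n)\<bar> \<le> \<bar>e n\<bar> + E'"
        using E[of n] \<open>ln \<phi> > 0\<close> by (simp add: e_def E'_def algebra_simps)
      ultimately show ?thesis using Suc by (simp add: algebra_simps)
    qed
  qed
  moreover have "E' \<ge> 0" using \<open>E \<ge> 0\<close> \<open>ln \<phi> > 0\<close> by (simp add: E'_def)
  ultimately show ?thesis unfolding e_def by blast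
qed

end

section \<open>Sparse exceptional digits\<close>

locale sparse_digits = metallic_approximation c a for c a +
  fixes pos :: "nat \<Rightarrow> nat" and w :: real
  assumes strict_mono_pos: "strict_mono pos" and pos_ge_1: "pos j \<ge> 1"
    and digit_neq_iff: "n \<ge> 1 \<Longrightarrow> c n \<noteq> a \<longleftrightarrow> n \<in> range pos"
    and pos_ratio: "(\<lambda>j. real (pos (Suc j)) / real (pos j)) \<longlonglongrightarrow> w" and w_gt_1: "w > 1"
begin

definition T :: "nat \<Rightarrow> real" where
  "T j = of_int (poly_height (approx_min_poly (pos j)))"

lemma index_over_pos_tendsto_0: "(\<lambda>j. (real j + 2) / real (pos j)) \<longlonglongrightarrow> 0"
proof (rule summable_LIMSEQ_zero, rule ratio_test_convergence)
  have pos_pos: "real (pos j) > 0" for j using pos_ge_1[of j] by simp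
  then show "eventually (\<lambda>j. 0 < (real j + 2) / real (pos j)) sequentially" by simp
  have "(\<lambda>j. (real j + 2) / (real (Suc j) + 2) * (real (pos (Suc j)) / real (pos j))) \<longlonglongrightarrow> 1 * w"
    by (intro tendsto_mult pos_ratio) real_asymp
  moreover have "(real j + 2) / (real (Suc j) + 2) * (real (pos (Suc j)) / real (pos j))
      = (real j + 2) / real (pos j) / ((real (Suc j) + 2) / real (pos (Suc j)))" for j
    using pos_pos[of j] pos_pos[of "Suc j"] by (simp add: field_simps)
  ultimately have "(\<lambda>j. (real j + 2) / real (pos j) / ((real (Suc j) + 2) / real (pos (Suc j))))
      \<longlonglongrightarrow> w"
    by (simp only: mult_1)
  then have "liminf (\<lambda>j. ereal
      ((real j + 2) / real (pos j) / ((real (Suc j) + 2) / real (pos (Suc j))))) = ereal w"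
    by (intro lim_imp_Liminf[OF trivial_limit_sequentially] tendsto_ereal)
  then show "1 < liminf (\<lambda>j. ereal
      ((real j + 2) / real (pos j) / ((real (Suc j) + 2) / real (pos (Suc j)))))"
    using w_gt_1 by (simp add: one_ereal_def)
qed

lemma ln_den_at_pos_tendsto: "(\<lambda>j. ln (den_at c (pos j) \<phi>) / real (pos j)) \<longlonglongrightarrow> ln \<phi>"
proof -
  obtain E where "E \<ge> 0" and E: "\<And>n. \<bar>ln (den_at c n \<phi>) - real n * ln \<phi>\<bar>
      \<le> E * (1 + real (card {i. 1 \<le> i \<and> i \<le> n \<and> c i \<noteq> a}))"
    using ln_den_at_approx by blast
  have bound: "\<bar>ln (den_at c (pos j) \<phi>) / real (pos j) - ln \<phi>\<bar> \<le> E * ((real j + 2) / real (pos j))"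
    for j
  proof -
    have "{i. 1 \<le> i \<and> i \<le> pos j \<and> c i \<noteq> a} \<subseteq> pos ` {..j}"
      using digit_neq_iff strict_mono_less_eq[OF strict_mono_pos] by auto
    then have "card {i. 1 \<le> i \<and> i \<le> pos j \<and> c i \<noteq> a} \<le> card (pos ` {..j})" by (intro card_mono) auto
    also have "\<dots> \<le> Suc j" using card_image_le[of "{..j}" pos] by simp
    finally have "E * (1 + real (card {i. 1 \<le> i \<and> i \<le> pos j \<and> c i \<noteq> a})) \<le> E * (real j + 2)"
      using \<open>E \<ge> 0\<close> by (intro mult_left_mono) auto
    then have "\<bar>ln (den_at c (pos j) \<phi>) - real (pos j) * ln \<phi>\<bar> \<le> E * (real j + 2)"
      using E[of "pos j"] by linarith
    then have "\<bar>ln (den_at c (pos j) \<phi>) - real (pos j) * ln \<phi>\<bar> / real (pos j)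
        \<le> E * (real j + 2) / real (pos j)"
      by (rule divide_right_mono) simp
    moreover have "ln (den_at c (pos j) \<phi>) / real (pos j) - ln \<phi>
        = (ln (den_at c (pos j) \<phi>) - real (pos j) * ln \<phi>) / real (pos j)"
      using pos_ge_1[of j] by (simp add: diff_divide_distrib)
    ultimately show ?thesis by (simp add: abs_divide)
  qed
  have "(\<lambda>j. E * ((real j + 2) / real (pos j))) \<longlonglongrightarrow> 0"
    using tendsto_mult_right_zero[OF index_over_pos_tendsto_0] .
  then show ?thesis
    by (rule LIM_zero_cancel[OF Lim_null_comparison, rotated])
      (simp add: bound del: times_divide_eq_right)
qed

lemma T_bigtheta: "T \<in> \<Theta>[principal UNIV](\<lambda>j. (q (pos j))\<^sup>2)"
  unfolding T_def
proof (rule landau_theta.compose[OF poly_height_approx_min_poly_bigtheta])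
  show "filterlim pos (principal {n. n \<ge> 1 \<and> c n \<noteq> a}) (principal UNIV)"
    using pos_ge_1 digit_neq_iff by (auto simp: filterlim_principal)
qed

lemma filterlim_pos: "filterlim (\<lambda>j. real (pos j)) at_top sequentially"
  using filterlim_compose[OF filterlim_real_sequentially filterlim_subseq[OF strict_mono_pos]] .

lemma T_ge_1: "T j \<ge> 1"
proof -
  have "approx_min_poly (pos j) \<noteq> 0"
    using degree_approx_min_poly[of "pos j"] by (metis degree_0 zero_neq_numeral)
  then show ?thesis using poly_height_ge_1 by (simp add: T_def)
qed

lemma ln_T_tendsto: "(\<lambda>j. ln (T j) / real (pos j)) \<longlonglongrightarrow> 2 * ln \<phi>"
proof -
  let ?V = "\<lambda>j. den_at c (pos j) \<phi>"
  have "(\<lambda>j. q (pos j)) \<in> \<Theta>[principal UNIV](?V)"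
    using landau_theta.compose[OF den_at_\<phi>_bigtheta, of pos "principal UNIV"]
    by (simp add: bigtheta_sym)
  then have "(\<lambda>j. (q (pos j))\<^sup>2) \<in> \<Theta>[principal UNIV](\<lambda>j. (?V j)\<^sup>2)"
    unfolding power2_eq_square by (intro landau_theta.mult)
  with T_bigtheta have "T \<in> \<Theta>[principal UNIV](\<lambda>j. (?V j)\<^sup>2)" by (rule landau_theta.trans)
  moreover have "T j > 0" "(?V j)\<^sup>2 > 0" for j using T_ge_1[of j] den_at_\<phi>_pos[of "pos j"] by auto
  ultimately obtain E where "\<And>j. \<bar>ln (T j) - ln ((?V j)\<^sup>2)\<bar> \<le> E"
    using bigtheta_ln_diff_bounded[of T UNIV "\<lambda>j. (?V j)\<^sup>2"] by blast
  then have E: "\<bar>ln (T j) - 2 * ln (?V j)\<bar> \<le> E" for j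
    using den_at_\<phi>_pos[of "pos j"] by (simp add: ln_realpow)
  have "(\<lambda>j. (ln (T j) - 2 * ln (?V j)) / real (pos j)) \<longlonglongrightarrow> 0"
  proof (rule Lim_null_comparison)
    show "eventually (\<lambda>j. norm ((ln (T j) - 2 * ln (?V j)) / real (pos j))
        \<le> E / real (pos j)) sequentially"
      using E by (simp add: abs_divide divide_right_mono)
    show "(\<lambda>j. E / real (pos j)) \<longlonglongrightarrow> 0"
      by (rule real_tendsto_divide_at_top[OF tendsto_const filterlim_pos])
  qed
  then have "(\<lambda>j. (ln (T j) - 2 * ln (?V j)) / real (pos j) + 2 * (ln (?V j) / real (pos j)))
      \<longlonglongrightarrow> 0 + 2 * ln \<phi>"
    by (intro tendsto_add tendsto_mult_left ln_den_at_pos_tendsto)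
  moreover have "(ln (T j) - 2 * ln (?V j)) / real (pos j) + 2 * (ln (?V j) / real (pos j))
      = ln (T j) / real (pos j)" for j
    by (simp add: diff_divide_distrib)
  ultimately show ?thesis by simp
qed

lemma ln_T_at_top: "filterlim (\<lambda>j. ln (T j)) at_top sequentially"
proof -
  have "filterlim (\<lambda>j. ln (T j) / real (pos j) * real (pos j)) at_top sequentially"
    using \<phi>_gt_1 by (intro filterlim_tendsto_pos_mult_at_top[OF ln_T_tendsto _ filterlim_pos]) simp
  moreover have "ln (T j) / real (pos j) * real (pos j) = ln (T j)" for j
    using pos_ge_1[of j] by simp
  ultimately show ?thesis by simp
qed

lemma T_at_top: "filterlim T at_top sequentially"
proof -
  have "filterlim (\<lambda>j. exp (ln (T j))) at_top sequentially"
    by (rule filterlim_compose[OF exp_at_top ln_T_at_top])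
  moreover have "exp (ln (T j)) = T j" for j using T_ge_1[of j] by simp
  ultimately show ?thesis by simp
qed

lemma ln_T_ratio: "(\<lambda>j. ln (T (Suc j)) / ln (T j)) \<longlonglongrightarrow> w"
proof -
  have "(\<lambda>j. ln (T (Suc j)) / real (pos (Suc j)) * (real (pos (Suc j)) / real (pos j))
      / (ln (T j) / real (pos j)))
      \<longlonglongrightarrow> 2 * ln \<phi> * w / (2 * ln \<phi>)"
    using \<phi>_gt_1 by (intro tendsto_intros LIMSEQ_Suc[OF ln_T_tendsto] pos_ratio ln_T_tendsto) simp
  moreover have "ln (T (Suc j)) / real (pos (Suc j)) * (real (pos (Suc j)) / real (pos j))
      / (ln (T j) / real (pos j))
      = ln (T (Suc j)) / ln (T j)" for j
    using pos_ge_1[of j] pos_ge_1[of "Suc j"] by simp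
  moreover have "2 * ln \<phi> * w / (2 * ln \<phi>) = w" using \<phi>_gt_1 by simp
  ultimately show ?thesis by (simp only:)
qed

lemma approximant_before_next_pos: "approximant (pos (Suc j) - 1) = approximant (pos j)"
proof -
  have approximant_eq: "approximant n = approximant (pos j)" if "pos j \<le> n" "n < pos (Suc j)" for n
    using that
  proof (induction n rule: dec_induct)
    case (step n)
    have "pos i \<noteq> Suc n" for i
      using step strict_mono_less[OF strict_mono_pos, of j i]
        strict_mono_less[OF strict_mono_pos, of i "Suc j"] by auto
    then have "Suc n \<notin> range pos" by (metis rangeE)
    then have "c (Suc n) = a" using digit_neq_iff[of "Suc n"] by simp
    then show ?case using step digit_Suc_eq_a(2) by simp
  qed simp
  have "pos j < pos (Suc j)" using strict_mono_pos by (simp add: strict_mono_less)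
  then show ?thesis by (intro approximant_eq) auto
qed

lemma dist_bigtheta: "(\<lambda>j. \<xi> - approximant (pos j)) \<in> \<Theta>[principal UNIV](\<lambda>j. 1 / T (Suc j))"
proof -
  let ?n = "\<lambda>j. pos (Suc j) - 1"
  have n: "Suc (?n j) = pos (Suc j)" for j using pos_ge_1[of "Suc j"] by simp
  have before_exception: "filterlim ?n (principal {n. c (Suc n) \<noteq> a}) (principal UNIV)"
    using n pos_ge_1 digit_neq_iff by (auto simp: filterlim_principal)
  have "(\<lambda>j. \<xi> - approximant (pos j)) \<in> \<Theta>[principal UNIV](\<lambda>j. 1 / (q (?n j))\<^sup>2)"
    using landau_theta.compose[OF dist_approximant_bigtheta before_exception]
    by (simp only: approximant_before_next_pos)
  also have "(\<lambda>j. q (pos (Suc j))) \<in> \<Theta>[principal UNIV](\<lambda>j. q (?n j))"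
    using landau_theta.compose[OF q_Suc_bigtheta, of ?n "principal UNIV"]
    by (simp only: n filterlim_principal) simp
  then have "(\<lambda>j. 1 / (q (?n j))\<^sup>2) \<in> \<Theta>[principal UNIV](\<lambda>j. 1 / (q (pos (Suc j)))\<^sup>2)"
    unfolding power2_eq_square
    by (intro bigtheta_divide_principal landau_theta.mult bigtheta_refl)
      (simp_all only: bigtheta_sym)
  also have "(\<lambda>j. 1 / (q (pos (Suc j)))\<^sup>2) \<in> \<Theta>[principal UNIV](\<lambda>j. 1 / T (Suc j))"
    using landau_theta.compose[OF T_bigtheta, of Suc "principal UNIV"]
    by (intro bigtheta_divide_principal bigtheta_refl) (simp add: bigtheta_sym)
  finally show ?thesis .
qed

sublocale approximations:
  quadratic_approximations \<xi> w "\<lambda>j. approximant (pos j)" "\<lambda>j. approx_min_poly (pos j)" T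
proof unfold_locales
  show "(\<lambda>j. \<xi> - approximant (pos j)) \<in> \<Theta>[principal UNIV](\<lambda>j. 1 / T (Suc j))"
    by (rule dist_bigtheta)
  have "(\<lambda>j. rpoly (approx_min_poly (pos j)) \<xi>) \<in> \<Theta>[principal UNIV](\<lambda>j. \<xi> - approximant (pos j))"
    using rpoly_approx_min_poly_bigtheta by (rule landau_theta.compose) simp
  then show "(\<lambda>j. rpoly (approx_min_poly (pos j)) \<xi>) \<in> \<Theta>[principal UNIV](\<lambda>j. 1 / T (Suc j))"
    using dist_bigtheta by (rule landau_theta.trans)
  show "(\<lambda>j. ln (T (Suc j)) / ln (T j)) \<longlonglongrightarrow> w" by (rule ln_T_ratio)
qed (simp_all add: T_def is_int_min_poly_approximant degree_approx_min_poly T_at_top)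

end

lemma sparse_digits_a_seq:
  assumes "w \<ge> 2" "a > 0" "b > 0" "a \<noteq> b"
  shows "sparse_digits (\<lambda>n. if n = 0 then 0 else a_seq a b w n) a (\<lambda>j. nat \<lfloor>w ^ j\<rfloor>) w"
proof
  let ?c = "\<lambda>n. if n = 0 then 0 else a_seq a b w n" and ?pos = "\<lambda>j. nat \<lfloor>w ^ j\<rfloor>"
  have power_ge_1: "w ^ j \<ge> 1" for j using assms(1) by (intro one_le_power) simp
  then have int_pos: "int (?pos j) = \<lfloor>w ^ j\<rfloor>" for j by (simp add: order_trans[OF zero_le_one])
  show "?pos j \<ge> 1" for j using power_ge_1[of j] by (simp add: le_nat_iff le_floor_iff)
  show "?c i \<ge> 1" if "i \<ge> 1" for i using that assms by (simp add: a_seq_def)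
  show "bdd_above (range ?c)" by (rule bdd_aboveI[of _ "max 0 (max a b)"]) (auto simp: a_seq_def)
  show "?c n \<noteq> a \<longleftrightarrow> n \<in> range ?pos" if "n \<ge> 1" for n
  proof -
    have "n = ?pos i \<longleftrightarrow> int n = \<lfloor>w ^ i\<rfloor>" for i by (metis int_pos nat_int)
    then have "n \<in> range ?pos \<longleftrightarrow> (\<exists>i. int n = \<lfloor>w ^ i\<rfloor>)" by blast
    then show ?thesis using that assms(4) by (simp add: a_seq_def)
  qed
  show "strict_mono ?pos"
  proof (rule strict_monoI_Suc)
    fix j
    have "w ^ j + 1 \<le> 2 * w ^ j" using power_ge_1[of j] by simp
    also have "\<dots> \<le> w ^ Suc j" using assms(1) power_ge_1[of j] by (simp add: mult_right_mono)
    finally have "\<lfloor>w ^ j + 1\<rfloor> \<le> \<lfloor>w ^ Suc j\<rfloor>" by (rule floor_mono)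
    then have "\<lfloor>w ^ j\<rfloor> < \<lfloor>w ^ Suc j\<rfloor>" by simp
    then show "?pos j < ?pos (Suc j)" by (metis int_pos of_nat_less_iff)
  qed
  define u where "u j = real_of_int \<lfloor>w ^ j\<rfloor> / w ^ j" for j
  have "((\<lambda>x. real_of_int \<lfloor>x\<rfloor> / x) \<longlongrightarrow> 1) at_top" by real_asymp
  moreover have "filterlim (\<lambda>j. w ^ j) at_top sequentially"
    using assms(1)
    by (intro filterlim_at_infinity_imp_filterlim_at_top filterlim_realpow_sequentially_gt1) auto
  ultimately have "u \<longlonglongrightarrow> 1" unfolding u_def by (rule filterlim_compose)
  then have "(\<lambda>j. w * (u (Suc j) / u j)) \<longlonglongrightarrow> w * (1 / 1)"
    by (intro tendsto_mult_left tendsto_divide LIMSEQ_Suc[of u]) auto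
  moreover have "real (?pos j) = of_int \<lfloor>w ^ j\<rfloor>" for j
    using arg_cong[OF int_pos[of j], of real_of_int] by (simp only: of_int_of_nat_eq)
  then have "w * (u (Suc j) / u j) = real (?pos (Suc j)) / real (?pos j)" for j
    using assms(1) by (simp add: u_def)
  ultimately show "(\<lambda>j. real (?pos (Suc j)) / real (?pos j)) \<longlonglongrightarrow> w"
    by (simp only: div_by_1 mult_1_right)
qed (use assms in auto)

theorem theorem5p4:
  fixes d :: nat and w :: real and a b :: int
  assumes "d \<ge> 2"
    and "w \<ge> (3 * real d + 2 + sqrt (9 * (real d)\<^sup>2 + 4 * real d + 4)) / 2"
    and "a > 0" and "b > 0" and "a \<noteq> b"
  shows "\<forall>n. 2 \<le> n \<and> n \<le> d \<longrightarrow>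
           w_star_exp n (xi a b w) = ereal (w - 1) \<and> w_exp n (xi a b w) = ereal w"
proof (intro allI impI)
  fix n assume n: "2 \<le> n \<and> n \<le> d"
  then have admissible: "admissible_degree w n" using admissible_degreeI[OF assms(2)] by blast
  then have "w \<ge> 2" by (rule admissible_degree_imp_ge_2)
  then interpret sparse_digits "\<lambda>n. if n = 0 then 0 else a_seq a b w n" a "\<lambda>j. nat \<lfloor>w ^ j\<rfloor>" w
    using assms(3-5) by (rule sparse_digits_a_seq)
  show "w_star_exp n (xi a b w) = ereal (w - 1) \<and> w_exp n (xi a b w) = ereal w"
    unfolding xi_def using n admissible
    by (intro conjI approximations.w_star_exp_eq approximations.w_exp_eq) auto
qed

end
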